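(* Let $\mathbb K$ be an uncountable field, let $A$ be an integral $\mathbb K$-algebra of finite type (an integral domain), let $M$ be a finitely generated torsion free $A$-module of rank $r$, let $B$ be an integral $\mathbb K$-algebra of finite type, and let $D:M\otimes_{\mathbb K}B\to M\otimes_{\mathbb K}B$ be a family of differential operators on $M$ of order $\le N$, i.e. a differential operator of order $\le N$ of the $A\otimes_{\mathbb K}B$-module $M\otimes_{\mathbb K}B$ relative to $B$. Assume that the family contains the identity operator or some other differential operator with kernel zero, i.e. that there is a point $s_0\in\operatorname{Spec}B$ such that $D_{s_0}$ is the identity or has zero kernel. Then for very general $\mathfrak m_s\in\operatorname{Spec}B$, the operator $D_s=D\otimes_B\kappa(s):M\otimes_{\mathbb K}\kappa(s)\to M\otimes_{\mathbb K}\kappa(s)$ has zero kernel.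
   Context: For a homomorphism of commutative rings $k\to R$ and an $R$-module $P$, the $N$-th jet module is $\mathcal J^N(P/k)=(R\otimes_kP)/I_{R/k}^{N+1}(R\otimes_kP)$, where $I_{R/k}$ is the kernel of the multiplication $R\otimes_kR\to R$, with $R$-module structure via the first factor, and $d^N_{P/k}:P\to\mathcal J^N(P/k)$, $p\mapsto\overline{1\otimes p}$. A differential operator $P_1\to P_2$ of order $\le N$ relative to $k$ is a $k$-linear map of the form $\widetilde D\circ d^N_{P_1/k}$ with $\widetilde D:\mathcal J^N(P_1/k)\to P_2$ $R$-linear. Here $\kappa(s)$ is the residue field of $s$. "For very general $s\in\operatorname{Spec}B$" means: for all $s$ outside a countable union of proper Zariski-closed subsets of $\operatorname{Spec}B$. *)

theory Defs
  imports
    "HOL-Algebra.Free_Abelian_Groups"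
    "HOL-Algebra.Generated_Rings"
    "HOL-Algebra.Ideal_Product"
    "HOL-Algebra.QuotRing"
    "Jordan_Normal_Form.Missing_VectorSpace"
begin

section \<open>Algebras and change of scalars\<close>

text \<open>
  A $k$-algebra is a record \<open>R\<close> with \<open>algebra k R\<close>; the structure homomorphism $k \to R$ is
  $c \mapsto c \cdot 1_R$. For a plain module the record fields \<open>mult\<close> and \<open>one\<close> carry no meaning;
  the constructions below copy them, so that each of them applies to modules and to algebras.
\<close>

definition structure_map :: "('r, 'a, 'x) module_scheme \<Rightarrow> 'r \<Rightarrow> 'a"
  where "structure_map A c = c \<odot>\<^bsub>A\<^esub> \<one>\<^bsub>A\<^esub>"

definition finite_type_algebra :: "('r, 'y) ring_scheme \<Rightarrow> ('r, 'a, 'x) module_scheme \<Rightarrow> bool"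
  where "finite_type_algebra k A \<longleftrightarrow> algebra k A \<and>
    (\<exists>S. finite S \<and> S \<subseteq> carrier A \<and> generate_ring A (structure_map A ` carrier k \<union> S) = carrier A)"

definition regular_module :: "('r, 'x) ring_scheme \<Rightarrow> ('r, 'r) module"
  where "regular_module R = \<lparr>carrier = carrier R, mult = mult R, one = one R, zero = zero R,
    add = add R, smult = mult R\<rparr>"

definition restrict_scalars :: "('r \<Rightarrow> 's) \<Rightarrow> ('s, 'm, 'x) module_scheme \<Rightarrow> ('r, 'm) module"
  where "restrict_scalars \<phi> M = \<lparr>carrier = carrier M, mult = mult M, one = one M, zero = zero M,
    add = add M, smult = (\<lambda>c m. \<phi> c \<odot>\<^bsub>M\<^esub> m)\<rparr>"

definition finitely_generated :: "('r, 'y) ring_scheme \<Rightarrow> ('r, 'm, 'x) module_scheme \<Rightarrow> bool"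
  where "finitely_generated R M \<longleftrightarrow>
    (\<exists>S. finite S \<and> S \<subseteq> carrier M \<and> LinearCombinations.module.span R M S = carrier M)"

definition torsion_free :: "('r, 'y) ring_scheme \<Rightarrow> ('r, 'm, 'x) module_scheme \<Rightarrow> bool"
  where "torsion_free R M \<longleftrightarrow>
    (\<forall>a\<in>carrier R. \<forall>m\<in>carrier M. a \<odot>\<^bsub>M\<^esub> m = \<zero>\<^bsub>M\<^esub> \<longrightarrow> a = \<zero>\<^bsub>R\<^esub> \<or> m = \<zero>\<^bsub>M\<^esub>)"

definition quotient_module :: "('r, 'm, 'x) module_scheme \<Rightarrow> 'm set \<Rightarrow> ('r, 'm set) module"
  where "quotient_module M H = \<lparr>carrier = a_rcosets\<^bsub>M\<^esub> H, mult = rcoset_mult M H,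
    one = H +>\<^bsub>M\<^esub> \<one>\<^bsub>M\<^esub>, zero = H, add = set_add M,
    smult = (\<lambda>c X. \<Union>x\<in>X. H +>\<^bsub>M\<^esub> (c \<odot>\<^bsub>M\<^esub> x))\<rparr>"

section \<open>Tensor products\<close>

text \<open>
  $P \otimes_k Q$ is the free abelian group on $P \times Q$ modulo the usual relations, so that its
  elements are cosets of finitely supported functions \<open>P \<times> Q \<Rightarrow> int\<close>.
\<close>

inductive_set tensor_relations ::
    "('k, 'y) ring_scheme \<Rightarrow> ('k, 'p, 'x) module_scheme \<Rightarrow> ('k, 'q, 'z) module_scheme
      \<Rightarrow> ('p \<times> 'q \<Rightarrow>\<^sub>0 int) set"
  for k P Q where
    add_left: "\<lbrakk>p \<in> carrier P; p' \<in> carrier P; q \<in> carrier Q\<rbrakk> \<Longrightarrow>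
      frag_of (p \<oplus>\<^bsub>P\<^esub> p', q) - frag_of (p, q) - frag_of (p', q) \<in> tensor_relations k P Q"
  | add_right: "\<lbrakk>p \<in> carrier P; q \<in> carrier Q; q' \<in> carrier Q\<rbrakk> \<Longrightarrow>
      frag_of (p, q \<oplus>\<^bsub>Q\<^esub> q') - frag_of (p, q) - frag_of (p, q') \<in> tensor_relations k P Q"
  | balanced: "\<lbrakk>c \<in> carrier k; p \<in> carrier P; q \<in> carrier Q\<rbrakk> \<Longrightarrow>
      frag_of (c \<odot>\<^bsub>P\<^esub> p, q) - frag_of (p, c \<odot>\<^bsub>Q\<^esub> q) \<in> tensor_relations k P Q"

definition tensor_null ::
    "('k, 'y) ring_scheme \<Rightarrow> ('k, 'p, 'x) module_scheme \<Rightarrow> ('k, 'q, 'z) module_scheme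
      \<Rightarrow> ('p \<times> 'q \<Rightarrow>\<^sub>0 int) set"
  where "tensor_null k P Q =
    generate (free_Abelian_group (carrier P \<times> carrier Q)) (tensor_relations k P Q)"

definition tensor_group ::
    "('k, 'y) ring_scheme \<Rightarrow> ('k, 'p, 'x) module_scheme \<Rightarrow> ('k, 'q, 'z) module_scheme
      \<Rightarrow> ('p \<times> 'q \<Rightarrow>\<^sub>0 int) set monoid"
  where "tensor_group k P Q =
    free_Abelian_group (carrier P \<times> carrier Q) Mod tensor_null k P Q"

definition pure_tensor ::
    "('k, 'y) ring_scheme \<Rightarrow> ('k, 'p, 'x) module_scheme \<Rightarrow> ('k, 'q, 'z) module_scheme
      \<Rightarrow> 'p \<Rightarrow> 'q \<Rightarrow> ('p \<times> 'q \<Rightarrow>\<^sub>0 int) set"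
  where "pure_tensor k P Q p q =
    tensor_null k P Q #>\<^bsub>free_Abelian_group (carrier P \<times> carrier Q)\<^esub> frag_of (p, q)"

text \<open>
  The homomorphism into the (multiplicatively written) abelian group \<open>G\<close> that is induced by a
  biadditive balanced map \<open>f\<close>: a coset is sent to the common value $\sum n_{p,q} f(p,q)$ of its
  representatives $\sum n_{p,q}\,(p,q)$. For a map that is not biadditive and balanced the value is
  meaningless.
\<close>

definition tensor_lift ::
    "('g, 'x) monoid_scheme \<Rightarrow> ('p \<Rightarrow> 'q \<Rightarrow> 'g) \<Rightarrow> ('p \<times> 'q \<Rightarrow>\<^sub>0 int) set \<Rightarrow> 'g"
  where "tensor_lift G f X = the_elem ((\<lambda>x.
    finprod G (\<lambda>(p, q). f p q [^]\<^bsub>G\<^esub> Poly_Mapping.lookup x (p, q)) (Poly_Mapping.keys x)) ` X)"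

text \<open>
  $P \otimes_k Q$ as a \<open>k\<close>-module; if \<open>P\<close> and \<open>Q\<close> are \<open>k\<close>-algebras, it is a \<open>k\<close>-algebra with
  $(p \otimes q)(p' \otimes q') = pp' \otimes qq'$.
\<close>

definition tensor ::
    "('k, 'y) ring_scheme \<Rightarrow> ('k, 'p, 'x) module_scheme \<Rightarrow> ('k, 'q, 'z) module_scheme
      \<Rightarrow> ('k, ('p \<times> 'q \<Rightarrow>\<^sub>0 int) set) module"
  where "tensor k P Q =
    \<lparr>carrier = carrier (tensor_group k P Q),
     mult = (\<lambda>X Y. tensor_lift (tensor_group k P Q)
        (\<lambda>p q. tensor_lift (tensor_group k P Q)
          (\<lambda>p' q'. pure_tensor k P Q (p \<otimes>\<^bsub>P\<^esub> p') (q \<otimes>\<^bsub>Q\<^esub> q')) Y) X),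
     one = pure_tensor k P Q \<one>\<^bsub>P\<^esub> \<one>\<^bsub>Q\<^esub>,
     zero = one (tensor_group k P Q),
     add = mult (tensor_group k P Q),
     smult = (\<lambda>c. tensor_lift (tensor_group k P Q) (\<lambda>p q. pure_tensor k P Q (c \<odot>\<^bsub>P\<^esub> p) q))\<rparr>"

text \<open>
  For \<open>k\<close>-algebras \<open>R\<close>, \<open>S\<close>, an \<open>R\<close>-module \<open>P\<close> and an \<open>S\<close>-module \<open>Q\<close>: the module $P \otimes_k Q$
  over the ring $R \otimes_k S$, with $(r \otimes s)(p \otimes q) = rp \otimes sq$.
\<close>

definition tensor_over ::
    "('k, 'y) ring_scheme \<Rightarrow> ('k, 'r, 'v) module_scheme \<Rightarrow> ('k, 's, 'w) module_scheme
      \<Rightarrow> ('r, 'p, 'x) module_scheme \<Rightarrow> ('s, 'q, 'z) module_scheme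
      \<Rightarrow> (('r \<times> 's \<Rightarrow>\<^sub>0 int) set, ('p \<times> 'q \<Rightarrow>\<^sub>0 int) set) module"
  where "tensor_over k R S P Q =
    (let Pk = restrict_scalars (structure_map R) P; Qk = restrict_scalars (structure_map S) Q;
         T = tensor k Pk Qk
     in \<lparr>carrier = carrier T, mult = mult T, one = one T, zero = zero T, add = add T,
         smult = (\<lambda>z x. tensor_lift (tensor_group k Pk Qk)
           (\<lambda>r s. tensor_lift (tensor_group k Pk Qk)
             (\<lambda>p q. pure_tensor k Pk Qk (r \<odot>\<^bsub>P\<^esub> p) (s \<odot>\<^bsub>Q\<^esub> q)) x) z)\<rparr>)"

section \<open>Fraction fields, rank, spectrum and residue fields\<close>

definition fraction :: "('a, 'x) ring_scheme \<Rightarrow> 'a \<Rightarrow> 'a \<Rightarrow> ('a \<times> 'a) set"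
  where "fraction R a b =
    {(c, d). c \<in> carrier R \<and> d \<in> carrier R - {\<zero>\<^bsub>R\<^esub>} \<and> a \<otimes>\<^bsub>R\<^esub> d = c \<otimes>\<^bsub>R\<^esub> b}"

definition fraction_field :: "('a, 'x) ring_scheme \<Rightarrow> ('a \<times> 'a) set ring"
  where "fraction_field R =
    \<lparr>carrier = {fraction R a b | a b. a \<in> carrier R \<and> b \<in> carrier R - {\<zero>\<^bsub>R\<^esub>}},
     mult = (\<lambda>X Y. \<Union>(a, b)\<in>X. \<Union>(c, d)\<in>Y. fraction R (a \<otimes>\<^bsub>R\<^esub> c) (b \<otimes>\<^bsub>R\<^esub> d)),
     one = fraction R \<one>\<^bsub>R\<^esub> \<one>\<^bsub>R\<^esub>,
     zero = fraction R \<zero>\<^bsub>R\<^esub> \<one>\<^bsub>R\<^esub>,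
     add = (\<lambda>X Y. \<Union>(a, b)\<in>X. \<Union>(c, d)\<in>Y.
       fraction R (a \<otimes>\<^bsub>R\<^esub> d \<oplus>\<^bsub>R\<^esub> c \<otimes>\<^bsub>R\<^esub> b) (b \<otimes>\<^bsub>R\<^esub> d))\<rparr>"

text \<open>The rank of a module over a domain \<open>R\<close> is $\dim_{\mathrm{Frac} R} (\mathrm{Frac} R \otimes_R M)$.\<close>

definition module_rank :: "('r, 'y) ring_scheme \<Rightarrow> ('r, 'm, 'x) module_scheme \<Rightarrow> nat"
  where "module_rank R M =
    (let F = fraction_field R;
         FR = restrict_scalars (\<lambda>a. fraction R a \<one>\<^bsub>R\<^esub>) (regular_module F)
     in vectorspace.dim F
          (restrict_scalars (\<lambda>c. pure_tensor R FR (regular_module R) c \<one>\<^bsub>R\<^esub>)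
            (tensor_over R FR (regular_module R) (regular_module F) M)))"

definition Spec :: "('b, 'x) ring_scheme \<Rightarrow> 'b set set"
  where "Spec B = {p. primeideal p B}"

definition zariski_closed :: "('b, 'x) ring_scheme \<Rightarrow> 'b set set \<Rightarrow> bool"
  where "zariski_closed B Z \<longleftrightarrow> (\<exists>E. E \<subseteq> carrier B \<and> Z = {p \<in> Spec B. E \<subseteq> p})"

definition very_general :: "('b, 'x) ring_scheme \<Rightarrow> ('b set \<Rightarrow> bool) \<Rightarrow> bool"
  where "very_general B \<Phi> \<longleftrightarrow>
    (\<exists>\<Z>. countable \<Z> \<and> (\<forall>Z\<in>\<Z>. zariski_closed B Z \<and> Z \<noteq> Spec B) \<and> (\<forall>s \<in> Spec B - \<Union>\<Z>. \<Phi> s))"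

text \<open>$\kappa(s) = \mathrm{Frac}(B/s)$, as a \<open>B\<close>-algebra.\<close>

definition residue_field :: "('b, 'x) ring_scheme \<Rightarrow> 'b set \<Rightarrow> ('b, ('b set \<times> 'b set) set) module"
  where "residue_field B s =
    restrict_scalars (\<lambda>b. fraction (B Quot s) (s +>\<^bsub>B\<^esub> b) \<one>\<^bsub>B Quot s\<^esub>)
      (regular_module (fraction_field (B Quot s)))"

section \<open>Jet modules and differential operators\<close>

text \<open>Throughout, \<open>R\<close> is a \<open>k\<close>-algebra and \<open>P\<close> is an \<open>R\<close>-module.\<close>

definition diagonal_ideal ::
    "('k, 'y) ring_scheme \<Rightarrow> ('k, 'r, 'x) module_scheme \<Rightarrow> ('r \<times> 'r \<Rightarrow>\<^sub>0 int) set set"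
  where "diagonal_ideal k R =
    a_kernel (tensor k R R) R (tensor_lift (add_monoid R) (\<lambda>x y. x \<otimes>\<^bsub>R\<^esub> y))"

definition jet_null ::
    "('k, 'y) ring_scheme \<Rightarrow> ('k, 'r, 'x) module_scheme \<Rightarrow> ('r, 'p, 'z) module_scheme \<Rightarrow> nat
      \<Rightarrow> ('r \<times> 'p \<Rightarrow>\<^sub>0 int) set set"
  where "jet_null k R P N =
    (let RR = tensor k R R; RP = tensor_over k R R (regular_module R) P
     in LinearCombinations.module.span RR RP
          {z \<odot>\<^bsub>RP\<^esub> x | z x. z \<in> diagonal_ideal k R [^]\<^bsub>ideals_set RR\<^esub> (N + 1) \<and> x \<in> carrier RP})"

definition jet_module ::
    "('k, 'y) ring_scheme \<Rightarrow> ('k, 'r, 'x) module_scheme \<Rightarrow> ('r, 'p, 'z) module_scheme \<Rightarrow> nat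
      \<Rightarrow> ('r, ('r \<times> 'p \<Rightarrow>\<^sub>0 int) set set) module"
  where "jet_module k R P N =
    restrict_scalars (\<lambda>r. pure_tensor k R R r \<one>\<^bsub>R\<^esub>)
      (quotient_module (tensor_over k R R (regular_module R) P) (jet_null k R P N))"

definition jet_map ::
    "('k, 'y) ring_scheme \<Rightarrow> ('k, 'r, 'x) module_scheme \<Rightarrow> ('r, 'p, 'z) module_scheme \<Rightarrow> nat
      \<Rightarrow> 'p \<Rightarrow> ('r \<times> 'p \<Rightarrow>\<^sub>0 int) set set"
  where "jet_map k R P N p =
    jet_null k R P N +>\<^bsub>tensor_over k R R (regular_module R) P\<^esub>
      pure_tensor k (restrict_scalars (structure_map R) (regular_module R))
        (restrict_scalars (structure_map R) P) \<one>\<^bsub>R\<^esub> p"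

definition diff_operators ::
    "('k, 'y) ring_scheme \<Rightarrow> ('k, 'r, 'x) module_scheme \<Rightarrow> ('r, 'p, 'z) module_scheme
      \<Rightarrow> ('r, 'q, 'w) module_scheme \<Rightarrow> nat \<Rightarrow> ('p \<Rightarrow> 'q) set"
  where "diff_operators k R P Q N =
    {D \<in> module_hom k (restrict_scalars (structure_map R) P) (restrict_scalars (structure_map R) Q).
      \<exists>D' \<in> module_hom R (jet_module k R P N) Q. \<forall>p\<in>carrier P. D p = D' (jet_map k R P N p)}"

section \<open>Families of differential operators\<close>

text \<open>$A \otimes_K B$ as a \<open>B\<close>-algebra and $M \otimes_K B$ as a module over it.\<close>

definition algebra_family ::
    "('k, 'y) ring_scheme \<Rightarrow> ('k, 'a, 'v) module_scheme \<Rightarrow> ('k, 'b, 'w) module_scheme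
      \<Rightarrow> ('b, ('a \<times> 'b \<Rightarrow>\<^sub>0 int) set) module"
  where "algebra_family K A B =
    restrict_scalars (pure_tensor K A B \<one>\<^bsub>A\<^esub>) (regular_module (tensor K A B))"

definition module_family ::
    "('k, 'y) ring_scheme \<Rightarrow> ('k, 'a, 'v) module_scheme \<Rightarrow> ('k, 'b, 'w) module_scheme
      \<Rightarrow> ('a, 'm, 'x) module_scheme
      \<Rightarrow> (('a \<times> 'b \<Rightarrow>\<^sub>0 int) set, ('m \<times> 'b \<Rightarrow>\<^sub>0 int) set) module"
  where "module_family K A B M = tensor_over K A B M (regular_module B)"

definition diff_operator_families ::
    "('k, 'y) ring_scheme \<Rightarrow> ('k, 'a, 'v) module_scheme \<Rightarrow> ('k, 'b, 'w) module_scheme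
      \<Rightarrow> ('a, 'm, 'x) module_scheme \<Rightarrow> nat
      \<Rightarrow> (('m \<times> 'b \<Rightarrow>\<^sub>0 int) set \<Rightarrow> ('m \<times> 'b \<Rightarrow>\<^sub>0 int) set) set"
  where "diff_operator_families K A B M N =
    diff_operators B (algebra_family K A B) (module_family K A B M) (module_family K A B M) N"

definition fibre ::
    "('k, 'y) ring_scheme \<Rightarrow> ('k, 'a, 'v) module_scheme \<Rightarrow> ('k, 'b, 'w) module_scheme
      \<Rightarrow> ('a, 'm, 'x) module_scheme \<Rightarrow> 'b set
      \<Rightarrow> ('k, ('m \<times> ('b set \<times> 'b set) set \<Rightarrow>\<^sub>0 int) set) module"
  where "fibre K A B M s =
    tensor K (restrict_scalars (structure_map A) M)
      (restrict_scalars (structure_map B) (residue_field B s))"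

text \<open>
  $D \otimes_B \kappa(s)$ is an endomorphism of $(M \otimes_K B) \otimes_B \kappa(s)$; it becomes one
  of $M \otimes_K \kappa(s)$ through the canonical isomorphism
  $(m \otimes b) \otimes c \mapsto m \otimes bc$.
\<close>

definition family_base_change ::
    "('k, 'y) ring_scheme \<Rightarrow> ('k, 'a, 'v) module_scheme \<Rightarrow> ('k, 'b, 'w) module_scheme
      \<Rightarrow> ('a, 'm, 'x) module_scheme \<Rightarrow> 'b set
      \<Rightarrow> ('b, (('m \<times> 'b \<Rightarrow>\<^sub>0 int) set \<times> ('b set \<times> 'b set) set \<Rightarrow>\<^sub>0 int) set) module"
  where "family_base_change K A B M s =
    tensor B (restrict_scalars (structure_map (algebra_family K A B)) (module_family K A B M))
      (residue_field B s)"

definition fibre_iso ::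
    "('k, 'y) ring_scheme \<Rightarrow> ('k, 'a, 'v) module_scheme \<Rightarrow> ('k, 'b, 'w) module_scheme
      \<Rightarrow> ('a, 'm, 'x) module_scheme \<Rightarrow> 'b set
      \<Rightarrow> (('m \<times> 'b \<Rightarrow>\<^sub>0 int) set \<times> ('b set \<times> 'b set) set \<Rightarrow>\<^sub>0 int) set
      \<Rightarrow> ('m \<times> ('b set \<times> 'b set) set \<Rightarrow>\<^sub>0 int) set"
  where "fibre_iso K A B M s =
    tensor_lift (add_monoid (fibre K A B M s))
      (\<lambda>x c. tensor_lift (add_monoid (fibre K A B M s))
        (\<lambda>m b. pure_tensor K (restrict_scalars (structure_map A) M)
          (restrict_scalars (structure_map B) (residue_field B s)) m (b \<odot>\<^bsub>residue_field B s\<^esub> c)) x)"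

definition operator_at ::
    "('k, 'y) ring_scheme \<Rightarrow> ('k, 'a, 'v) module_scheme \<Rightarrow> ('k, 'b, 'w) module_scheme
      \<Rightarrow> ('a, 'm, 'x) module_scheme \<Rightarrow> (('m \<times> 'b \<Rightarrow>\<^sub>0 int) set \<Rightarrow> ('m \<times> 'b \<Rightarrow>\<^sub>0 int) set) \<Rightarrow> 'b set
      \<Rightarrow> ('m \<times> ('b set \<times> 'b set) set \<Rightarrow>\<^sub>0 int) set
      \<Rightarrow> ('m \<times> ('b set \<times> 'b set) set \<Rightarrow>\<^sub>0 int) set"
  where "operator_at K A B M D s =
    fibre_iso K A B M s
    \<circ> tensor_lift (add_monoid (family_base_change K A B M s))
        (\<lambda>x c. pure_tensor B
          (restrict_scalars (structure_map (algebra_family K A B)) (module_family K A B M))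
          (residue_field B s) (D x) c)
    \<circ> inv_into (carrier (family_base_change K A B M s)) (fibre_iso K A B M s)"

definition zero_kernel_at ::
    "('k, 'y) ring_scheme \<Rightarrow> ('k, 'a, 'v) module_scheme \<Rightarrow> ('k, 'b, 'w) module_scheme
      \<Rightarrow> ('a, 'm, 'x) module_scheme \<Rightarrow> (('m \<times> 'b \<Rightarrow>\<^sub>0 int) set \<Rightarrow> ('m \<times> 'b \<Rightarrow>\<^sub>0 int) set) \<Rightarrow> 'b set
      \<Rightarrow> bool"
  where "zero_kernel_at K A B M D s \<longleftrightarrow>
    a_kernel (fibre K A B M s) (fibre K A B M s) (operator_at K A B M D s)
      = {\<zero>\<^bsub>fibre K A B M s\<^esub>}"

end

theory Submission
  imports Defs
begin

text \<open>
  $D$ is in particular $B$-linear, and this is all that is needed. As $A$ is of finite type and $M$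
  is finitely generated, $M$ has a countable $K$-basis $(e_j)$, so that $D$ is given by a
  column-finite matrix $(d_{ij})$ over $B$ with $D(e_j \otimes 1) = \sum_i e_i \otimes d_{ij}$,
  and $D_s$ is given by the image of this matrix over $\kappa(s)$. Hence $D_s$ has zero kernel if
  and only if every finite set of columns is linearly independent over $\kappa(s)$. For a given
  finite set of columns this is an open condition on $s$, it holds at $s_0$, and there are countably
  many finite sets of columns.
\<close>

section \<open>Tensor products\<close>

text \<open>The residue field varies with the point, so elimination has to take place over
  \<open>B\<close>: matrix entries stay in \<open>B\<close>, the unknown coefficients lie in a
  \<open>B\<close>-module \<open>C\<close> that stands for kappa(s), and an entry outside
  \<open>s\<close> acts injectively on \<open>C\<close>. In place of minors, a pivot is picked at
  \<open>s\<^sub>0\<close> and one column is eliminated without division; this step is an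
  equivalence at every point whose prime does not contain the pivot. The product of the successive
  pivots is a single element \<open>f\<close> of \<open>B\<close> outside \<open>s\<^sub>0\<close>,
  and f \<notin> s forces independence at \<open>s\<close>. The closed set V(f) is proper because it
  misses \<open>s\<^sub>0\<close>. Before coordinates can be used, the concrete definitions must be
  made computable: tensor products are sets of cosets, maps out of them are read off from
  representatives, and the operator on a fibre is defined through \<open>inv_into\<close> of a
  canonical isomorphism. Hence the universal property and an explicit inverse.\<close>

text \<open>
  \<open>tensor_group\<close> and the additive group of \<open>tensor\<close> differ only in the record extension, which forces
  the following two congruence rules.
\<close>

lemma comm_group_cong:
  assumes "carrier G = carrier H" "mult G = mult H" "one G = one H" and G: "comm_group G"
  shows "comm_group H"
  using G
  unfolding comm_group_def comm_monoid_def comm_monoid_axioms_def group_def group_axioms_def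
    monoid_def Units_def assms(1-3) .

lemma tensor_lift_cong:
  assumes "carrier G = carrier H" "mult G = mult H" "one G = one H"
  shows "tensor_lift G f = tensor_lift H f"
  unfolding tensor_lift_def finprod_def int_pow_def nat_pow_def m_inv_def assms ..

text \<open>The definitions lift into \<open>tensor_group\<close>, whereas the universal property
  below speaks of additive groups of ring records; this equation passes between the two.\<close>

lemma tensor_lift_tensor_group:
  "tensor_lift (tensor_group k P Q) f = tensor_lift (add_monoid (tensor k P Q)) f"
  by (rule tensor_lift_cong) (simp_all add: tensor_def)

text \<open>The integer combination that \<open>tensor_lift\<close> evaluates on one representative,
  before cosets enter: the extension of \<open>f\<close> to the free abelian group.\<close>

definition frag_lift :: "('g, 'x) monoid_scheme \<Rightarrow> ('p \<Rightarrow> 'q \<Rightarrow> 'g) \<Rightarrow> ('p \<times> 'q \<Rightarrow>\<^sub>0 int) \<Rightarrow> 'g"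
  where "frag_lift G f x = finprod G
    (\<lambda>(p, q). f p q [^]\<^bsub>G\<^esub> Poly_Mapping.lookup x (p, q)) (Poly_Mapping.keys x)"

text \<open>The product ranges over the support, which changes under addition and may shrink by
  cancellation. All three products are rewritten over the union of the two supports, where the
  additional factors are zeroth powers.\<close>

lemma (in comm_group) frag_lift_hom:
  assumes f: "\<And>p q. (p, q) \<in> S \<Longrightarrow> f p q \<in> carrier G"
  shows "frag_lift G f \<in> hom (free_Abelian_group S) G"
proof (rule homI)
  have cl: "f p q [^] (n::int) \<in> carrier G" if "(p, q) \<in> S" for p q n
    using f[OF that] by (rule int_pow_closed)
  fix x assume "x \<in> carrier (free_Abelian_group S)"
  then show "frag_lift G f x \<in> carrier G"
    unfolding frag_lift_def using cl by (intro finprod_closed) auto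
next
  have cl: "f p q [^] (n::int) \<in> carrier G" if "(p, q) \<in> S" for p q n
    using f[OF that] by (rule int_pow_closed)
  let ?h = "\<lambda>x. \<lambda>(p, q). f p q [^] Poly_Mapping.lookup x (p, q)"
  have ext: "frag_lift G f x = finprod G (?h x) E"
    if "finite E" "Poly_Mapping.keys x \<subseteq> E" "E \<subseteq> S" for x E
    unfolding frag_lift_def
    by (rule finprod_mono_neutral_cong_left) (use that cl in \<open>auto simp: in_keys_iff\<close>)
  fix x y assume xy: "x \<in> carrier (free_Abelian_group S)" "y \<in> carrier (free_Abelian_group S)"
  let ?E = "Poly_Mapping.keys x \<union> Poly_Mapping.keys y"
  have E: "finite ?E" "?E \<subseteq> S" using xy by auto
  have "frag_lift G f (x + y) = finprod G (?h (x + y)) ?E"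
    using E keys_add[of x y] by (intro ext)
  also have "\<dots> = finprod G (\<lambda>a. ?h x a \<otimes> ?h y a) ?E"
  proof (rule finprod_cong')
    show "?E = ?E" ..
    show "(\<lambda>a. ?h x a \<otimes> ?h y a) \<in> ?E \<rightarrow> carrier G" using E cl by auto
    show "?h (x + y) a = ?h x a \<otimes> ?h y a" if "a \<in> ?E" for a
      using f[of "fst a" "snd a"] E(2) that by (cases a) (auto simp: lookup_add int_pow_mult)
  qed
  also have "\<dots> = finprod G (?h x) ?E \<otimes> finprod G (?h y) ?E"
    by (rule finprod_multf) (use E cl in auto)
  also have "\<dots> = frag_lift G f x \<otimes> frag_lift G f y"
    using E by (simp add: ext[of ?E])
  finally show "frag_lift G f (x \<otimes>\<^bsub>free_Abelian_group S\<^esub> y) = frag_lift G f x \<otimes> frag_lift G f y"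
    by simp
qed

lemma (in comm_group) frag_lift_of: "f p q \<in> carrier G \<Longrightarrow> frag_lift G f (frag_of (p, q)) = f p q"
  by (simp add: frag_lift_def int_pow_1)

lemma (in abelian_group) add_diff_cancel_left:
  assumes "a \<in> carrier G" "b \<in> carrier G"
  shows "(a \<oplus> b) \<ominus> a = b"
  unfolding a_minus_def using assms a_comm[of "a \<oplus> b" "\<ominus> a"] by (simp add: r_neg1)

section \<open>Elements of a tensor product and its universal property\<close>

locale module_pair = P: module k P + Q: module k Q for k (structure) and P and Q
begin

abbreviation "FA \<equiv> free_Abelian_group (carrier P \<times> carrier Q)"
abbreviation "T \<equiv> tensor k P Q"
abbreviation "pt \<equiv> pure_tensor k P Q"

text \<open>The target enters as an abelian group only: the lifts that occur go between modules over
  different rings, so balancedness just compares the two actions of \<open>k\<close> on the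
  arguments.\<close>

definition balanced_map :: "('h, 'x) ring_scheme \<Rightarrow> ('c \<Rightarrow> 'e \<Rightarrow> 'h) \<Rightarrow> bool"
  where "balanced_map H f \<longleftrightarrow>
    (\<forall>p\<in>carrier P. \<forall>q\<in>carrier Q. f p q \<in> carrier H) \<and>
    (\<forall>p\<in>carrier P. \<forall>p'\<in>carrier P. \<forall>q\<in>carrier Q. f (p \<oplus>\<^bsub>P\<^esub> p') q = f p q \<oplus>\<^bsub>H\<^esub> f p' q) \<and>
    (\<forall>p\<in>carrier P. \<forall>q\<in>carrier Q. \<forall>q'\<in>carrier Q. f p (q \<oplus>\<^bsub>Q\<^esub> q') = f p q \<oplus>\<^bsub>H\<^esub> f p q') \<and>
    (\<forall>c\<in>carrier k. \<forall>p\<in>carrier P. \<forall>q\<in>carrier Q. f (c \<odot>\<^bsub>P\<^esub> p) q = f p (c \<odot>\<^bsub>Q\<^esub> q))"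

lemma balanced_mapI:
  assumes "\<And>p q. \<lbrakk>p \<in> carrier P; q \<in> carrier Q\<rbrakk> \<Longrightarrow> f p q \<in> carrier H"
    and "\<And>p p' q. \<lbrakk>p \<in> carrier P; p' \<in> carrier P; q \<in> carrier Q\<rbrakk> \<Longrightarrow>
      f (p \<oplus>\<^bsub>P\<^esub> p') q = f p q \<oplus>\<^bsub>H\<^esub> f p' q"
    and "\<And>p q q'. \<lbrakk>p \<in> carrier P; q \<in> carrier Q; q' \<in> carrier Q\<rbrakk> \<Longrightarrow>
      f p (q \<oplus>\<^bsub>Q\<^esub> q') = f p q \<oplus>\<^bsub>H\<^esub> f p q'"
    and "\<And>c p q. \<lbrakk>c \<in> carrier k; p \<in> carrier P; q \<in> carrier Q\<rbrakk> \<Longrightarrow>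
      f (c \<odot>\<^bsub>P\<^esub> p) q = f p (c \<odot>\<^bsub>Q\<^esub> q)"
  shows "balanced_map H f"
  using assms by (simp add: balanced_map_def)

lemma tensor_relations_closed: "tensor_relations k P Q \<subseteq> carrier FA"
proof
  fix x assume "x \<in> tensor_relations k P Q"
  then show "x \<in> carrier FA"
    by cases (auto dest!: subsetD[OF keys_diff] split: if_splits)
qed

lemma subgroup_tensor_null: "subgroup (tensor_null k P Q) FA"
  unfolding tensor_null_def
  by (intro group.generate_is_subgroup group_free_Abelian_group tensor_relations_closed)

lemma normal_tensor_null: "tensor_null k P Q \<lhd> FA"
  by (intro comm_group.subgroup_imp_normal abelian_free_Abelian_group subgroup_tensor_null)

lemma tensor_relation_null: "x \<in> tensor_relations k P Q \<Longrightarrow> x \<in> tensor_null k P Q"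
  unfolding tensor_null_def by (rule generate.incl)

lemma abelian_group_tensor: "abelian_group T"
proof -
  have "comm_group (tensor_group k P Q)"
    unfolding tensor_group_def
    by (intro comm_group.abelian_FactGroup abelian_free_Abelian_group subgroup_tensor_null)
  then have "comm_group (add_monoid T)"
    by (rule comm_group_cong[rotated 3]) (simp_all add: tensor_def)
  then show ?thesis
    by (intro abelian_group.intro abelian_monoid.intro abelian_group_axioms.intro
        comm_group.axioms(1))
qed

sublocale T: abelian_group T
  by (rule abelian_group_tensor)

lemma carrier_tensor: "carrier T = rcosets\<^bsub>FA\<^esub> (tensor_null k P Q)"
  by (simp add: tensor_def tensor_group_def FactGroup_def)

lemma coset_add:
  assumes "x \<in> carrier FA" "y \<in> carrier FA"
  shows "(tensor_null k P Q #>\<^bsub>FA\<^esub> x) \<oplus>\<^bsub>T\<^esub> (tensor_null k P Q #>\<^bsub>FA\<^esub> y) = tensor_null k P Q #>\<^bsub>FA\<^esub> (x + y)"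
  using normal.rcos_sum[OF normal_tensor_null assms]
  by (simp add: tensor_def tensor_group_def FactGroup_def)

lemma coset_eq:
  assumes "x \<in> carrier FA" "y \<in> carrier FA" "x - y \<in> tensor_null k P Q"
  shows "tensor_null k P Q #>\<^bsub>FA\<^esub> x = tensor_null k P Q #>\<^bsub>FA\<^esub> y"
proof -
  have "x \<in> tensor_null k P Q #>\<^bsub>FA\<^esub> y"
    using assms(3) unfolding r_coset_def by (intro UN_I[of "x - y"]) simp_all
  then show ?thesis
    by (rule group.repr_independence[OF group_free_Abelian_group _ assms(2) subgroup_tensor_null, symmetric])
qed

lemma pt_closed [simp, intro]: "\<lbrakk>p \<in> carrier P; q \<in> carrier Q\<rbrakk> \<Longrightarrow> pt p q \<in> carrier T"
  unfolding carrier_tensor pure_tensor_def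
  by (intro group.rcosetsI group_free_Abelian_group subgroup.subset subgroup_tensor_null) simp

lemma pt_add_left:
  assumes "p \<in> carrier P" "p' \<in> carrier P" "q \<in> carrier Q"
  shows "pt (p \<oplus>\<^bsub>P\<^esub> p') q = pt p q \<oplus>\<^bsub>T\<^esub> pt p' q"
proof -
  have "pt p q \<oplus>\<^bsub>T\<^esub> pt p' q = tensor_null k P Q #>\<^bsub>FA\<^esub> (frag_of (p, q) + frag_of (p', q))"
    unfolding pure_tensor_def by (rule coset_add) (use assms in auto)
  also have "\<dots> = pt (p \<oplus>\<^bsub>P\<^esub> p') q"
    unfolding pure_tensor_def
  proof (rule coset_eq[symmetric])
    show "frag_of (p, q) + frag_of (p', q) \<in> carrier FA"
      using assms keys_add[of "frag_of (p, q)" "frag_of (p', q)"] by auto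
  qed (use assms tensor_relation_null[OF tensor_relations.add_left[OF assms]] in \<open>simp_all add: diff_diff_eq\<close>)
  finally show ?thesis ..
qed

lemma pt_add_right:
  assumes "p \<in> carrier P" "q \<in> carrier Q" "q' \<in> carrier Q"
  shows "pt p (q \<oplus>\<^bsub>Q\<^esub> q') = pt p q \<oplus>\<^bsub>T\<^esub> pt p q'"
proof -
  have "pt p q \<oplus>\<^bsub>T\<^esub> pt p q' = tensor_null k P Q #>\<^bsub>FA\<^esub> (frag_of (p, q) + frag_of (p, q'))"
    unfolding pure_tensor_def by (rule coset_add) (use assms in auto)
  also have "\<dots> = pt p (q \<oplus>\<^bsub>Q\<^esub> q')"
    unfolding pure_tensor_def
  proof (rule coset_eq[symmetric])
    show "frag_of (p, q) + frag_of (p, q') \<in> carrier FA"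
      using assms keys_add[of "frag_of (p, q)" "frag_of (p, q')"] by auto
  qed (use assms tensor_relation_null[OF tensor_relations.add_right[OF assms]] in \<open>simp_all add: diff_diff_eq\<close>)
  finally show ?thesis ..
qed

lemma pt_balanced:
  assumes "c \<in> carrier k" "p \<in> carrier P" "q \<in> carrier Q"
  shows "pt (c \<odot>\<^bsub>P\<^esub> p) q = pt p (c \<odot>\<^bsub>Q\<^esub> q)"
  unfolding pure_tensor_def
  by (rule coset_eq) (use assms tensor_relation_null[OF tensor_relations.balanced[OF assms]] in simp_all)

lemma zero_tensor: "\<zero>\<^bsub>T\<^esub> = tensor_null k P Q"
  by (simp add: tensor_def tensor_group_def FactGroup_def)

lemma pt_zero_left [simp]: "q \<in> carrier Q \<Longrightarrow> pt \<zero>\<^bsub>P\<^esub> q = \<zero>\<^bsub>T\<^esub>"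
  using pt_add_left[of "\<zero>\<^bsub>P\<^esub>" "\<zero>\<^bsub>P\<^esub>" q] by simp

lemma pt_zero_right [simp]: "p \<in> carrier P \<Longrightarrow> pt p \<zero>\<^bsub>Q\<^esub> = \<zero>\<^bsub>T\<^esub>"
  using pt_add_right[of p "\<zero>\<^bsub>Q\<^esub>" "\<zero>\<^bsub>Q\<^esub>"] by simp

lemma pt_minus_left: "\<lbrakk>p \<in> carrier P; q \<in> carrier Q\<rbrakk> \<Longrightarrow> pt (\<ominus>\<^bsub>P\<^esub> p) q = \<ominus>\<^bsub>T\<^esub> pt p q"
  using pt_add_left[of "\<ominus>\<^bsub>P\<^esub> p" p q]
  by (intro T.minus_equality[symmetric]) (simp_all add: P.l_neg)

text \<open>Every element is a sum of pure tensors without integer coefficients, because a sign is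
  absorbed into the first factor: -(p \<otimes> q) = (-p) \<otimes> q. This is why no case for
  negatives is left.\<close>

lemma tensor_induct [consumes 1, case_names pure add]:
  assumes x: "x \<in> carrier T"
    and pure: "\<And>p q. \<lbrakk>p \<in> carrier P; q \<in> carrier Q\<rbrakk> \<Longrightarrow> R (pt p q)"
    and add: "\<And>x y. \<lbrakk>x \<in> carrier T; y \<in> carrier T; R x; R y\<rbrakk> \<Longrightarrow> R (x \<oplus>\<^bsub>T\<^esub> y)"
  shows "R x"
proof -
  define N where "N = tensor_null k P Q"
  have cos: "N #>\<^bsub>FA\<^esub> y \<in> carrier T" if "Poly_Mapping.keys y \<subseteq> carrier P \<times> carrier Q" for y
    unfolding carrier_tensor N_def
    using that by (intro group.rcosetsI group_free_Abelian_group subgroup.subset subgroup_tensor_null) simp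
  have cos_zero: "N #>\<^bsub>FA\<^esub> 0 = \<zero>\<^bsub>T\<^esub>"
    using group.coset_mult_one[OF group_free_Abelian_group subgroup.subset[OF subgroup_tensor_null]]
    by (simp add: N_def zero_tensor)
  have neg: "N #>\<^bsub>FA\<^esub> (- y) = \<ominus>\<^bsub>T\<^esub> (N #>\<^bsub>FA\<^esub> y)" if "Poly_Mapping.keys y \<subseteq> carrier P \<times> carrier Q" for y
    using that coset_add[of "- y" y] by (intro T.minus_equality[symmetric] cos) (simp_all add: N_def[symmetric] cos_zero)
  \<comment> \<open>Induction on the free abelian group has a case for differences, so the claim is
    carried for a coset and its negative together.\<close>
  have main: "R (N #>\<^bsub>FA\<^esub> y) \<and> R (\<ominus>\<^bsub>T\<^esub> (N #>\<^bsub>FA\<^esub> y))"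
    if "Poly_Mapping.keys y \<subseteq> carrier P \<times> carrier Q" for y
    using that
  proof (induction rule: free_Abelian_group_induct[consumes 1, case_names zero diff of])
    case zero
    have "R (pt \<zero>\<^bsub>P\<^esub> \<zero>\<^bsub>Q\<^esub>)" by (intro pure) simp_all
    then have "R \<zero>\<^bsub>T\<^esub>" by simp
    moreover have "\<ominus>\<^bsub>T\<^esub> \<zero>\<^bsub>T\<^esub> = \<zero>\<^bsub>T\<^esub>"
      by (rule T.minus_equality) simp_all
    ultimately show ?case by (simp only: cos_zero simp_thms)
  next
    case (diff x y)
    have "N #>\<^bsub>FA\<^esub> (x - y) = (N #>\<^bsub>FA\<^esub> x) \<oplus>\<^bsub>T\<^esub> \<ominus>\<^bsub>T\<^esub> (N #>\<^bsub>FA\<^esub> y)"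
      using diff coset_add[of x "- y"] by (simp add: N_def[symmetric] neg)
    moreover have "\<ominus>\<^bsub>T\<^esub> (N #>\<^bsub>FA\<^esub> (x - y)) = \<ominus>\<^bsub>T\<^esub> (N #>\<^bsub>FA\<^esub> x) \<oplus>\<^bsub>T\<^esub> (N #>\<^bsub>FA\<^esub> y)"
      using diff cos unfolding calculation by (simp add: T.minus_add)
    ultimately show ?case using diff cos by (simp add: add)
  next
    case (of a)
    then show ?case
      using pure[of "fst a" "snd a"] pure[of "\<ominus>\<^bsub>P\<^esub> fst a" "snd a"]
      by (auto simp: pt_minus_left) (auto simp: N_def pure_tensor_def)
  qed
  obtain y where "Poly_Mapping.keys y \<subseteq> carrier P \<times> carrier Q" "x = N #>\<^bsub>FA\<^esub> y"
    using x unfolding carrier_tensor N_def by (auto simp: RCOSETS_def)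
  then show ?thesis using main by simp
qed

text \<open>The universal property. \<open>frag_lift\<close> is a homomorphism that kills the
  generating relations, hence the subgroup they generate, hence is constant on each coset. The image
  set in \<open>tensor_lift\<close> is thus a singleton and \<open>the_elem\<close> reads off its
  value.\<close>

lemma lift:
  fixes H (structure)
  assumes H: "abelian_group H" and f: "balanced_map H f"
  shows lift_closed: "x \<in> carrier T \<Longrightarrow> tensor_lift (add_monoid H) f x \<in> carrier H"
    and lift_add: "\<lbrakk>x \<in> carrier T; y \<in> carrier T\<rbrakk> \<Longrightarrow> tensor_lift (add_monoid H) f (x \<oplus>\<^bsub>T\<^esub> y)
      = tensor_lift (add_monoid H) f x \<oplus>\<^bsub>H\<^esub> tensor_lift (add_monoid H) f y"
    and lift_pt: "\<lbrakk>p \<in> carrier P; q \<in> carrier Q\<rbrakk> \<Longrightarrow> tensor_lift (add_monoid H) f (pt p q) = f p q"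
proof -
  interpret H: abelian_group H by fact
  let ?G = "add_monoid H"
  let ?h = "frag_lift (add_monoid H) f"
  have fc: "\<And>p q. \<lbrakk>p \<in> carrier P; q \<in> carrier Q\<rbrakk> \<Longrightarrow> f p q \<in> carrier H"
    using f by (simp add: balanced_map_def)
  have hom: "?h \<in> hom FA ?G"
    by (rule comm_group.frag_lift_hom[OF H.a_comm_group]) (use fc in auto)
  have h_of: "?h (frag_of (p, q)) = f p q" if "p \<in> carrier P" "q \<in> carrier Q" for p q
    by (rule comm_group.frag_lift_of[OF H.a_comm_group]) (use fc that in simp)
  interpret h: group_hom FA ?G ?h
    by (intro group_hom.intro group_hom_axioms.intro hom H.a_group group_free_Abelian_group)
  have hd: "?h (x - y) = ?h x \<ominus>\<^bsub>H\<^esub> ?h y" if "x \<in> carrier FA" "y \<in> carrier FA" for x y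
    using h.hom_mult[of x "- y"] h.hom_inv[of y] that
    by (simp add: H.minus_eq a_inv_def)
  have cF: "frag_of a - frag_of b \<in> carrier FA" if "a \<in> carrier P \<times> carrier Q" "b \<in> carrier P \<times> carrier Q" for a b
    using that by (auto dest!: subsetD[OF keys_diff] split: if_splits)
  have rel: "?h x = \<zero>\<^bsub>H\<^esub>" if "x \<in> tensor_relations k P Q" for x
    using that
  proof cases
    case (add_left p p' q)
    then show ?thesis using f fc
      by (simp add: hd cF h_of del: carrier_free_Abelian_group_iff)
        (simp add: balanced_map_def H.add_diff_cancel_left)
  next
    case (add_right p q q')
    then show ?thesis using f fc
      by (simp add: hd cF h_of del: carrier_free_Abelian_group_iff)
        (simp add: balanced_map_def H.add_diff_cancel_left)
  next
    case (balanced c p q)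
    then show ?thesis using f fc
      by (simp add: hd cF h_of del: carrier_free_Abelian_group_iff)
        (simp add: balanced_map_def H.minus_eq H.r_neg)
  qed
  have null: "?h x = \<zero>\<^bsub>H\<^esub>" if "x \<in> tensor_null k P Q" for x
  proof -
    have "tensor_null k P Q \<subseteq> kernel FA ?G ?h"
      unfolding tensor_null_def
      by (rule group.generate_subgroup_incl[OF group_free_Abelian_group _ h.subgroup_kernel])
        (use subsetD[OF tensor_relations_closed] rel in \<open>simp add: kernel_def subset_iff\<close>)
    then show ?thesis using that by (auto simp: kernel_def)
  qed
  have val: "tensor_lift ?G f (tensor_null k P Q #>\<^bsub>FA\<^esub> y) = ?h y" if y: "y \<in> carrier FA" for y
  proof -
    have "?h z = ?h y" if "z \<in> tensor_null k P Q #>\<^bsub>FA\<^esub> y" for z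
    proof -
      obtain n where n: "n \<in> tensor_null k P Q" "z = n \<otimes>\<^bsub>FA\<^esub> y"
        using \<open>z \<in> _\<close> by (auto simp: r_coset_def)
      then have "n \<in> carrier FA" using subgroup.subset[OF subgroup_tensor_null] by blast
      then have "?h z = ?h n \<otimes>\<^bsub>?G\<^esub> ?h y" unfolding n(2) using y by (rule h.hom_mult)
      then show ?thesis using null[OF n(1)] h.hom_closed[OF y] by simp
    qed
    moreover have "y \<in> tensor_null k P Q #>\<^bsub>FA\<^esub> y"
      using y by (intro group.rcos_self group_free_Abelian_group subgroup_tensor_null)
    ultimately have "?h ` (tensor_null k P Q #>\<^bsub>FA\<^esub> y) = {?h y}" by blast
    then show ?thesis
      unfolding tensor_lift_def frag_lift_def[abs_def] by simp
  qed
  have rep: "\<exists>y\<in>carrier FA. x = tensor_null k P Q #>\<^bsub>FA\<^esub> y" if "x \<in> carrier T" for x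
    using that unfolding carrier_tensor by (auto simp: RCOSETS_def)
  show "tensor_lift ?G f x \<in> carrier H" if "x \<in> carrier T"
    using rep[OF that] val h.hom_closed by force
  show "tensor_lift ?G f (x \<oplus>\<^bsub>T\<^esub> y) = tensor_lift ?G f x \<oplus>\<^bsub>H\<^esub> tensor_lift ?G f y"
    if xy: "x \<in> carrier T" "y \<in> carrier T"
  proof -
    obtain u v where uv: "u \<in> carrier FA" "v \<in> carrier FA" "x = tensor_null k P Q #>\<^bsub>FA\<^esub> u"
      "y = tensor_null k P Q #>\<^bsub>FA\<^esub> v" using rep xy by meson
    have "u + v \<in> carrier FA" using group.is_monoid[OF group_free_Abelian_group, THEN monoid.m_closed, OF uv(1,2)] by simp
    then show ?thesis
      using h.hom_mult[OF uv(1,2)] unfolding uv(3,4) coset_add[OF uv(1,2)]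
      by (simp only: val uv) simp
  qed
  show "tensor_lift ?G f (pt p q) = f p q" if "p \<in> carrier P" "q \<in> carrier Q"
    unfolding pure_tensor_def using that by (subst val) (auto simp: h_of)
qed

end

section \<open>Restriction of scalars, and lifts that depend on parameters\<close>

lemma abelian_group_cong:
  assumes "carrier G = carrier H" "add G = add H" "zero G = zero H" and "abelian_group G"
  shows "abelian_group H"
proof -
  have "comm_group (add_monoid H)"
    using abelian_group.a_comm_group[OF assms(4)] by (rule comm_group_cong[rotated 3]) (simp_all add: assms)
  then show ?thesis
    by (intro abelian_group.intro abelian_monoid.intro abelian_group_axioms.intro
        comm_group.axioms(1))
qed

lemma restrict_scalars_simps [simp]:
  "carrier (restrict_scalars \<phi> M) = carrier M"
  "add (restrict_scalars \<phi> M) = add M"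
  "zero (restrict_scalars \<phi> M) = zero M"
  "mult (restrict_scalars \<phi> M) = mult M"
  "one (restrict_scalars \<phi> M) = one M"
  "smult (restrict_scalars \<phi> M) c m = \<phi> c \<odot>\<^bsub>M\<^esub> m"
  by (simp_all add: restrict_scalars_def)

lemma regular_module_simps [simp]:
  "carrier (regular_module R) = carrier R"
  "add (regular_module R) = add R"
  "zero (regular_module R) = zero R"
  "mult (regular_module R) = mult R"
  "one (regular_module R) = one R"
  "smult (regular_module R) = mult R"
  by (simp_all add: regular_module_def)

lemma module_restrict_scalars:
  assumes "cring k" "module R M" "\<phi> \<in> ring_hom k R"
  shows "module k (restrict_scalars \<phi> M)"
proof -
  interpret M: module R M by fact
  show ?thesis
  proof (rule moduleI)
    show "abelian_group (restrict_scalars \<phi> M)"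
      by (rule abelian_group_cong[OF _ _ _ M.abelian_group_axioms]) simp_all
  qed (use assms(3) in \<open>simp_all add: assms(1) ring_hom_closed ring_hom_add ring_hom_mult ring_hom_one
      M.smult_l_distr M.smult_r_distr M.smult_assoc1\<close>)
qed

lemma (in cring) module_regular: "module R (regular_module R)"
proof (rule moduleI)
  show "abelian_group (regular_module R)"
    by (rule abelian_group_cong[OF _ _ _ abelian_group_axioms]) simp_all
qed (simp_all add: l_distr r_distr m_assoc is_cring)

text \<open>\<open>smult_assoc2\<close> pulls a scalar out of the left factor; commutativity carries
  this over to the right one.\<close>

lemma (in algebra) mult_smult:
  assumes "a \<in> carrier R" "x \<in> carrier M" "y \<in> carrier M"
  shows "x \<otimes>\<^bsub>M\<^esub> (a \<odot>\<^bsub>M\<^esub> y) = a \<odot>\<^bsub>M\<^esub> (x \<otimes>\<^bsub>M\<^esub> y)"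
proof -
  have "x \<otimes>\<^bsub>M\<^esub> (a \<odot>\<^bsub>M\<^esub> y) = (a \<odot>\<^bsub>M\<^esub> y) \<otimes>\<^bsub>M\<^esub> x"
    using assms by (intro cring.cring_simprules(14)[OF M_cring]) auto
  also have "\<dots> = a \<odot>\<^bsub>M\<^esub> (y \<otimes>\<^bsub>M\<^esub> x)" using assms by (intro smult_assoc2)
  also have "y \<otimes>\<^bsub>M\<^esub> x = x \<otimes>\<^bsub>M\<^esub> y" using assms by (intro cring.cring_simprules(14)[OF M_cring])
  finally show ?thesis .
qed

lemma (in algebra) structure_map_mult:
  "\<lbrakk>a \<in> carrier R; x \<in> carrier M\<rbrakk> \<Longrightarrow> structure_map M a \<otimes>\<^bsub>M\<^esub> x = a \<odot>\<^bsub>M\<^esub> x"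
  by (simp add: structure_map_def smult_assoc2)

lemma (in algebra) structure_map_hom: "structure_map M \<in> ring_hom R M"
proof (rule ring_hom_memI)
  fix a b assume "a \<in> carrier R" "b \<in> carrier R"
  then show "structure_map M (a \<otimes> b) = structure_map M a \<otimes>\<^bsub>M\<^esub> structure_map M b"
    using structure_map_mult[of a "structure_map M b"] by (simp add: structure_map_def smult_assoc1)
qed (simp_all add: structure_map_def smult_l_distr)

lemma module_restrict_structure_map:
  assumes "algebra k R" "module R M"
  shows "module k (restrict_scalars (structure_map R) M)"
  using assms by (intro module_restrict_scalars[where R = R] algebra.structure_map_hom algebra.R_cring)

text \<open>Products and actions on tensor products are two nested lifts, and the outer one makes
  sense once the inner one is balanced as a function of its parameters \<open>r\<close> and
  \<open>s\<close>. On a pure tensor this is the assumption \<open>left\<close>, and it survives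
  sums since the inner lift is additive in \<open>x\<close>.\<close>

lemma bilift_balanced:
  assumes RS: "module_pair k R S" and PQ: "module_pair k P Q" and H: "abelian_group H"
    and left: "\<And>p q. \<lbrakk>p \<in> carrier P; q \<in> carrier Q\<rbrakk> \<Longrightarrow>
      module_pair.balanced_map k R S H (\<lambda>r s. f r s p q)"
    and right: "\<And>r s. \<lbrakk>r \<in> carrier R; s \<in> carrier S\<rbrakk> \<Longrightarrow> module_pair.balanced_map k P Q H (f r s)"
    and x: "x \<in> carrier (tensor k P Q)"
  shows "module_pair.balanced_map k R S H (\<lambda>r s. tensor_lift (add_monoid H) (f r s) x)"
proof -
  interpret RS: module_pair k R S by fact
  interpret PQ: module_pair k P Q by fact
  interpret H: abelian_group H by fact
  let ?L = "\<lambda>r s. tensor_lift (add_monoid H) (f r s)"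
  have L: "?L r s (PQ.pt p q) = f r s p q"
    if "r \<in> carrier R" "s \<in> carrier S" "p \<in> carrier P" "q \<in> carrier Q" for r s p q
    using PQ.lift_pt[OF H right] that by simp
  have A: "?L r s (x \<oplus>\<^bsub>PQ.T\<^esub> y) = ?L r s x \<oplus>\<^bsub>H\<^esub> ?L r s y"
    if "r \<in> carrier R" "s \<in> carrier S" "x \<in> carrier PQ.T" "y \<in> carrier PQ.T" for r s x y
    using PQ.lift_add[OF H right] that by simp
  have C: "?L r s x \<in> carrier H" if "r \<in> carrier R" "s \<in> carrier S" "x \<in> carrier PQ.T" for r s x
    using PQ.lift_closed[OF H right] that by simp
  show ?thesis
    using x
  proof (induction rule: PQ.tensor_induct)
    case (pure p q)
    then show ?case using left[OF pure] by (simp add: RS.balanced_map_def L)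
  next
    case (add x y)
    then show ?case
      by (simp add: RS.balanced_map_def A C H.a_ac)
  qed
qed

lemma tensor_simps:
  "mult (tensor k P Q) = (\<lambda>X Y. tensor_lift (add_monoid (tensor k P Q))
        (\<lambda>p q. tensor_lift (add_monoid (tensor k P Q))
          (\<lambda>p' q'. pure_tensor k P Q (p \<otimes>\<^bsub>P\<^esub> p') (q \<otimes>\<^bsub>Q\<^esub> q')) Y) X)"
  "one (tensor k P Q) = pure_tensor k P Q \<one>\<^bsub>P\<^esub> \<one>\<^bsub>Q\<^esub>"
  unfolding tensor_lift_tensor_group[symmetric] by (simp_all add: tensor_def)

lemma tensor_over_simps:
  "carrier (tensor_over k R S P Q) =
    carrier (tensor k (restrict_scalars (structure_map R) P) (restrict_scalars (structure_map S) Q))"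
  "add (tensor_over k R S P Q) =
    add (tensor k (restrict_scalars (structure_map R) P) (restrict_scalars (structure_map S) Q))"
  "zero (tensor_over k R S P Q) =
    zero (tensor k (restrict_scalars (structure_map R) P) (restrict_scalars (structure_map S) Q))"
  "smult (tensor_over k R S P Q) =
    (let Pk = restrict_scalars (structure_map R) P; Qk = restrict_scalars (structure_map S) Q;
         T = tensor k Pk Qk
     in (\<lambda>z x. tensor_lift (add_monoid T)
           (\<lambda>r s. tensor_lift (add_monoid T)
             (\<lambda>p q. pure_tensor k Pk Qk (r \<odot>\<^bsub>P\<^esub> p) (s \<odot>\<^bsub>Q\<^esub> q)) x) z))"
  unfolding tensor_lift_tensor_group[symmetric] Let_def by (simp_all add: tensor_over_def Let_def)

section \<open>The fibres of a family\<close>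

locale algebra_pair = KA: algebra K A + KB: algebra K B for K and A and B
begin

sublocale AB: module_pair K A B
  by (intro module_pair.intro KA.module KB.module)

lemma balanced_mult:
  assumes "a \<in> carrier A" "b \<in> carrier B"
  shows "AB.balanced_map AB.T (\<lambda>a' b'. AB.pt (a \<otimes>\<^bsub>A\<^esub> a') (b \<otimes>\<^bsub>B\<^esub> b'))"
  using assms
  by (intro AB.balanced_mapI)
    (simp_all add: KA.r_distr KB.r_distr AB.pt_add_left AB.pt_add_right KA.mult_smult KB.mult_smult
      AB.pt_balanced)

lemma balanced_mult':
  assumes "a' \<in> carrier A" "b' \<in> carrier B"
  shows "AB.balanced_map AB.T (\<lambda>a b. AB.pt (a \<otimes>\<^bsub>A\<^esub> a') (b \<otimes>\<^bsub>B\<^esub> b'))"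
  using assms
  by (intro AB.balanced_mapI)
    (simp_all add: KA.l_distr KB.l_distr AB.pt_add_left AB.pt_add_right KA.smult_assoc2 KB.smult_assoc2
      AB.pt_balanced)

lemma pt_mult_pt:
  assumes "a \<in> carrier A" "b \<in> carrier B" "a' \<in> carrier A" "b' \<in> carrier B"
  shows "AB.pt a b \<otimes>\<^bsub>AB.T\<^esub> AB.pt a' b' = AB.pt (a \<otimes>\<^bsub>A\<^esub> a') (b \<otimes>\<^bsub>B\<^esub> b')"
proof -
  have "AB.balanced_map AB.T (\<lambda>p q. tensor_lift (add_monoid AB.T)
      (\<lambda>p' q'. AB.pt (p \<otimes>\<^bsub>A\<^esub> p') (q \<otimes>\<^bsub>B\<^esub> q')) (AB.pt a' b'))"
    by (rule bilift_balanced[OF AB.module_pair_axioms AB.module_pair_axioms AB.T.abelian_group_axioms])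
      (use assms balanced_mult balanced_mult' in auto)
  then show ?thesis
    unfolding tensor_simps using assms
    by (simp add: AB.lift_pt[OF AB.T.abelian_group_axioms] balanced_mult)
qed

text \<open>\<open>B\<close> acts through 1 \<otimes> b, and the structure map is this action on the
  unit 1 \<otimes> 1; the multiplication rule for pure tensors collapses the product.\<close>

lemma structure_map_algebra_family:
  assumes "b \<in> carrier B"
  shows "structure_map (algebra_family K A B) b = AB.pt \<one>\<^bsub>A\<^esub> b"
  using assms pt_mult_pt[of "\<one>\<^bsub>A\<^esub>" b "\<one>\<^bsub>A\<^esub>" "\<one>\<^bsub>B\<^esub>"]
  by (simp add: structure_map_def algebra_family_def tensor_simps(2))

end

locale family = algebra_pair K A B + MA: module A M for K A B M
begin

abbreviation "Mk \<equiv> restrict_scalars (structure_map A) M"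
abbreviation "Bk \<equiv> restrict_scalars (structure_map B) (regular_module B)"

lemma module_Mk: "module K Mk"
  by (intro module_restrict_structure_map KA.algebra_axioms MA.module_axioms)

lemma module_Bk: "module K Bk"
  by (intro module_restrict_structure_map KB.algebra_axioms cring.module_regular KB.M_cring)

sublocale MB: module_pair K Mk Bk
  by (intro module_pair.intro module_Mk module_Bk)

abbreviation "PB \<equiv> restrict_scalars (structure_map (algebra_family K A B)) (module_family K A B M)"

lemma module_family_simps [simp]:
  "carrier (module_family K A B M) = carrier MB.T"
  "add (module_family K A B M) = add MB.T"
  "zero (module_family K A B M) = zero MB.T"
  by (simp_all add: module_family_def tensor_over_simps)

text \<open>Together with \<open>balanced_tensor_smult'\<close> this makes (a \<otimes> b)(m
  \<otimes> b') = am \<otimes> bb' well defined: here in the module variables, there in the ring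
  variables.\<close>

lemma balanced_tensor_smult:
  assumes "a \<in> carrier A" "b \<in> carrier B"
  shows "MB.balanced_map MB.T (\<lambda>m b'. MB.pt (a \<odot>\<^bsub>M\<^esub> m) (b \<otimes>\<^bsub>B\<^esub> b'))"
proof (rule MB.balanced_mapI)
  fix c m b' assume cm: "c \<in> carrier K" "m \<in> carrier Mk" "b' \<in> carrier Bk"
  note c = ring_hom_closed[OF KA.structure_map_hom cm(1)] ring_hom_closed[OF KB.structure_map_hom cm(1)]
  have "a \<odot>\<^bsub>M\<^esub> (c \<odot>\<^bsub>Mk\<^esub> m) = c \<odot>\<^bsub>Mk\<^esub> (a \<odot>\<^bsub>M\<^esub> m)"
    using cm assms c by (simp add: KA.m_comm flip: MA.smult_assoc1)
  moreover have "b \<otimes>\<^bsub>B\<^esub> (c \<odot>\<^bsub>Bk\<^esub> b') = c \<odot>\<^bsub>Bk\<^esub> (b \<otimes>\<^bsub>B\<^esub> b')"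
    using cm assms c by (simp add: KB.m_lcomm)
  ultimately show "MB.pt (a \<odot>\<^bsub>M\<^esub> (c \<odot>\<^bsub>Mk\<^esub> m)) (b \<otimes>\<^bsub>B\<^esub> b') = MB.pt (a \<odot>\<^bsub>M\<^esub> m) (b \<otimes>\<^bsub>B\<^esub> (c \<odot>\<^bsub>Bk\<^esub> b'))"
    using assms cm MB.pt_balanced[of c "a \<odot>\<^bsub>M\<^esub> m" "b \<otimes>\<^bsub>B\<^esub> b'"] by simp
next
  fix m m' b' assume "m \<in> carrier Mk" "m' \<in> carrier Mk" "b' \<in> carrier Bk"
  then show "MB.pt (a \<odot>\<^bsub>M\<^esub> (m \<oplus>\<^bsub>Mk\<^esub> m')) (b \<otimes>\<^bsub>B\<^esub> b') =
      MB.pt (a \<odot>\<^bsub>M\<^esub> m) (b \<otimes>\<^bsub>B\<^esub> b') \<oplus>\<^bsub>MB.T\<^esub> MB.pt (a \<odot>\<^bsub>M\<^esub> m') (b \<otimes>\<^bsub>B\<^esub> b')"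
    using assms MB.pt_add_left[of "a \<odot>\<^bsub>M\<^esub> m" "a \<odot>\<^bsub>M\<^esub> m'" "b \<otimes>\<^bsub>B\<^esub> b'"]
    by (simp add: MA.smult_r_distr)
next
  fix m b' b'' assume "m \<in> carrier Mk" "b' \<in> carrier Bk" "b'' \<in> carrier Bk"
  then show "MB.pt (a \<odot>\<^bsub>M\<^esub> m) (b \<otimes>\<^bsub>B\<^esub> (b' \<oplus>\<^bsub>Bk\<^esub> b'')) =
      MB.pt (a \<odot>\<^bsub>M\<^esub> m) (b \<otimes>\<^bsub>B\<^esub> b') \<oplus>\<^bsub>MB.T\<^esub> MB.pt (a \<odot>\<^bsub>M\<^esub> m) (b \<otimes>\<^bsub>B\<^esub> b'')"
    using assms MB.pt_add_right[of "a \<odot>\<^bsub>M\<^esub> m" "b \<otimes>\<^bsub>B\<^esub> b'" "b \<otimes>\<^bsub>B\<^esub> b''"]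
    by (simp add: KB.r_distr)
qed (use assms in simp)

lemma balanced_tensor_smult':
  assumes "m \<in> carrier M" "b' \<in> carrier B"
  shows "AB.balanced_map MB.T (\<lambda>a b. MB.pt (a \<odot>\<^bsub>M\<^esub> m) (b \<otimes>\<^bsub>B\<^esub> b'))"
proof (rule AB.balanced_mapI)
  fix c a b assume cab: "c \<in> carrier K" "a \<in> carrier A" "b \<in> carrier B"
  note c = ring_hom_closed[OF KA.structure_map_hom cab(1)] ring_hom_closed[OF KB.structure_map_hom cab(1)]
  have "(c \<odot>\<^bsub>A\<^esub> a) \<odot>\<^bsub>M\<^esub> m = c \<odot>\<^bsub>Mk\<^esub> (a \<odot>\<^bsub>M\<^esub> m)"
    using cab assms c by (simp add: KA.structure_map_mult flip: MA.smult_assoc1)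
  moreover have "(c \<odot>\<^bsub>B\<^esub> b) \<otimes>\<^bsub>B\<^esub> b' = c \<odot>\<^bsub>Bk\<^esub> (b \<otimes>\<^bsub>B\<^esub> b')"
    using cab assms c by (simp add: KB.smult_assoc2 KB.structure_map_mult)
  ultimately show "MB.pt ((c \<odot>\<^bsub>A\<^esub> a) \<odot>\<^bsub>M\<^esub> m) (b \<otimes>\<^bsub>B\<^esub> b') = MB.pt (a \<odot>\<^bsub>M\<^esub> m) ((c \<odot>\<^bsub>B\<^esub> b) \<otimes>\<^bsub>B\<^esub> b')"
    using assms cab MB.pt_balanced[of c "a \<odot>\<^bsub>M\<^esub> m" "b \<otimes>\<^bsub>B\<^esub> b'"] by simp
next
  fix a a' b assume "a \<in> carrier A" "a' \<in> carrier A" "b \<in> carrier B"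
  then show "MB.pt ((a \<oplus>\<^bsub>A\<^esub> a') \<odot>\<^bsub>M\<^esub> m) (b \<otimes>\<^bsub>B\<^esub> b') =
      MB.pt (a \<odot>\<^bsub>M\<^esub> m) (b \<otimes>\<^bsub>B\<^esub> b') \<oplus>\<^bsub>MB.T\<^esub> MB.pt (a' \<odot>\<^bsub>M\<^esub> m) (b \<otimes>\<^bsub>B\<^esub> b')"
    using assms MB.pt_add_left[of "a \<odot>\<^bsub>M\<^esub> m" "a' \<odot>\<^bsub>M\<^esub> m" "b \<otimes>\<^bsub>B\<^esub> b'"]
    by (simp add: MA.smult_l_distr)
next
  fix a b b'' assume "a \<in> carrier A" "b \<in> carrier B" "b'' \<in> carrier B"
  then show "MB.pt (a \<odot>\<^bsub>M\<^esub> m) ((b \<oplus>\<^bsub>B\<^esub> b'') \<otimes>\<^bsub>B\<^esub> b') =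
      MB.pt (a \<odot>\<^bsub>M\<^esub> m) (b \<otimes>\<^bsub>B\<^esub> b') \<oplus>\<^bsub>MB.T\<^esub> MB.pt (a \<odot>\<^bsub>M\<^esub> m) (b'' \<otimes>\<^bsub>B\<^esub> b')"
    using assms MB.pt_add_right[of "a \<odot>\<^bsub>M\<^esub> m" "b \<otimes>\<^bsub>B\<^esub> b'" "b'' \<otimes>\<^bsub>B\<^esub> b'"]
    by (simp add: KB.l_distr)
qed (use assms in simp)

lemma balanced_scale:
  assumes "b \<in> carrier B"
  shows "MB.balanced_map MB.T (\<lambda>m b'. MB.pt m (b \<otimes>\<^bsub>B\<^esub> b'))"
  using balanced_tensor_smult[OF KA.one_closed assms] ring_hom_closed[OF KA.structure_map_hom]
  by (simp add: MB.balanced_map_def)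

text \<open>The action of \<open>B\<close> on M \<otimes> B is defined by way of A \<otimes> B and
  two nested lifts. Evaluating the outer lift at 1 \<otimes> b leaves multiplication by
  \<open>b\<close> in the second factor.\<close>

lemma smult_PB:
  assumes b: "b \<in> carrier B" and x: "x \<in> carrier MB.T"
  shows "b \<odot>\<^bsub>PB\<^esub> x = tensor_lift (add_monoid MB.T) (\<lambda>m b'. MB.pt m (b \<otimes>\<^bsub>B\<^esub> b')) x"
proof -
  have "AB.balanced_map MB.T (\<lambda>a b. tensor_lift (add_monoid MB.T)
      (\<lambda>m b'. MB.pt (a \<odot>\<^bsub>M\<^esub> m) (b \<otimes>\<^bsub>B\<^esub> b')) x)"
    by (rule bilift_balanced[OF AB.module_pair_axioms MB.module_pair_axioms MB.T.abelian_group_axioms])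
      (use x balanced_tensor_smult balanced_tensor_smult' in auto)
  then have "b \<odot>\<^bsub>PB\<^esub> x = tensor_lift (add_monoid MB.T)
      (\<lambda>m b'. MB.pt (\<one>\<^bsub>A\<^esub> \<odot>\<^bsub>M\<^esub> m) (b \<otimes>\<^bsub>B\<^esub> b')) x"
    using b by (simp add: Let_def module_family_def tensor_over_simps structure_map_algebra_family
        AB.lift_pt[OF MB.T.abelian_group_axioms])
  \<comment> \<open>The law 1 m = m holds on the carrier only, so the two lifted maps may differ as
    functions; their lifts are compared on pure tensors.\<close>
  also have "\<dots> = tensor_lift (add_monoid MB.T) (\<lambda>m b'. MB.pt m (b \<otimes>\<^bsub>B\<^esub> b')) x"
    using x
  proof (induction rule: MB.tensor_induct)
    case (pure m b')
    then show ?case using b balanced_tensor_smult[OF KA.one_closed b]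
      by (simp add: MB.lift_pt[OF MB.T.abelian_group_axioms] balanced_scale)
  next
    case (add x y)
    then show ?case using b balanced_tensor_smult[OF KA.one_closed b]
      by (simp add: MB.lift_add[OF MB.T.abelian_group_axioms] balanced_scale)
  qed
  finally show ?thesis .
qed

lemma smult_PB_pt:
  "\<lbrakk>b \<in> carrier B; m \<in> carrier M; b' \<in> carrier B\<rbrakk> \<Longrightarrow> b \<odot>\<^bsub>PB\<^esub> MB.pt m b' = MB.pt m (b \<otimes>\<^bsub>B\<^esub> b')"
  using smult_PB[of b "MB.pt m b'"] MB.lift_pt[OF MB.T.abelian_group_axioms balanced_scale, of b m b']
  by simp

lemma smult_PB_add:
  "\<lbrakk>b \<in> carrier B; x \<in> carrier MB.T; y \<in> carrier MB.T\<rbrakk> \<Longrightarrow>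
    b \<odot>\<^bsub>PB\<^esub> (x \<oplus>\<^bsub>MB.T\<^esub> y) = b \<odot>\<^bsub>PB\<^esub> x \<oplus>\<^bsub>MB.T\<^esub> b \<odot>\<^bsub>PB\<^esub> y"
  using MB.lift_add[OF MB.T.abelian_group_axioms balanced_scale, of b x y] by (simp only: smult_PB MB.T.a_closed)

lemma smult_PB_closed: "\<lbrakk>b \<in> carrier B; x \<in> carrier MB.T\<rbrakk> \<Longrightarrow> b \<odot>\<^bsub>PB\<^esub> x \<in> carrier MB.T"
  using MB.lift_closed[OF MB.T.abelian_group_axioms balanced_scale, of b x] by (simp only: smult_PB)

lemma module_PB: "module B PB"
proof (rule moduleI[OF KB.M_cring])
  note [simp del] = restrict_scalars_simps(6)
  note [simp] = smult_PB_pt smult_PB_closed smult_PB_add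
  show "abelian_group PB"
    by (rule abelian_group_cong[OF _ _ _ MB.T.abelian_group_axioms]) simp_all
  show "\<one>\<^bsub>B\<^esub> \<odot>\<^bsub>PB\<^esub> x = x" if "x \<in> carrier PB" for x
  proof -
    have "x \<in> carrier MB.T" using that by simp
    then show ?thesis by (induction rule: MB.tensor_induct) simp_all
  qed
  fix a x assume a: "a \<in> carrier B" and x: "x \<in> carrier PB"
  then have x': "x \<in> carrier MB.T" by simp
  show "a \<odot>\<^bsub>PB\<^esub> x \<in> carrier PB" using a x by simp
  show "a \<odot>\<^bsub>PB\<^esub> (x \<oplus>\<^bsub>PB\<^esub> y) = a \<odot>\<^bsub>PB\<^esub> x \<oplus>\<^bsub>PB\<^esub> a \<odot>\<^bsub>PB\<^esub> y" if "y \<in> carrier PB" for y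
    using a x that by simp
  fix b assume b: "b \<in> carrier B"
  show "(a \<oplus>\<^bsub>B\<^esub> b) \<odot>\<^bsub>PB\<^esub> x = a \<odot>\<^bsub>PB\<^esub> x \<oplus>\<^bsub>PB\<^esub> b \<odot>\<^bsub>PB\<^esub> x"
    using x'
  proof (induction rule: MB.tensor_induct)
    case (pure m b')
    then show ?case
      using a b MB.pt_add_right[of m "a \<otimes>\<^bsub>B\<^esub> b'" "b \<otimes>\<^bsub>B\<^esub> b'"] by (simp add: KB.l_distr)
  next
    case (add x y)
    then show ?case using a b by (simp add: MB.T.a_ac)
  qed
  show "(a \<otimes>\<^bsub>B\<^esub> b) \<odot>\<^bsub>PB\<^esub> x = a \<odot>\<^bsub>PB\<^esub> (b \<odot>\<^bsub>PB\<^esub> x)"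
    using x' by (induction rule: MB.tensor_induct) (use a b in \<open>simp_all add: KB.m_assoc\<close>)
qed

end

section \<open>Base change of a family along a \<open>B\<close>-module\<close>

locale family_fibre = family K A B M + C: module B C for K A B M C
begin

abbreviation "Ck \<equiv> restrict_scalars (structure_map B) C"

sublocale MC: module_pair K Mk Ck
  by (intro module_pair.intro module_Mk module_restrict_structure_map KB.algebra_axioms C.module_axioms)

sublocale BC: module_pair B PB C
  by (intro module_pair.intro module_PB C.module_axioms)

text \<open>For C = kappa(s) and c = 1 this is the restriction of a section of the family to the
  fibre at \<open>s\<close>; a general \<open>c\<close> takes the place of 1.\<close>

definition "act c = tensor_lift (add_monoid MC.T) (\<lambda>m b. MC.pt m (b \<odot>\<^bsub>C\<^esub> c))"

definition "to_fibre = tensor_lift (add_monoid MC.T) (\<lambda>x c. act c x)"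

text \<open>An explicit inverse of \<open>to_fibre\<close>. The operator on the fibre is defined
  with \<open>inv_into\<close>, which this formula makes computable.\<close>

definition "from_fibre = tensor_lift (add_monoid BC.T) (\<lambda>m c. BC.pt (MB.pt m \<one>\<^bsub>B\<^esub>) c)"

lemma balanced_smult:
  assumes "c \<in> carrier C"
  shows "MB.balanced_map MC.T (\<lambda>m b. MC.pt m (b \<odot>\<^bsub>C\<^esub> c))"
proof (rule MB.balanced_mapI)
  fix k m b assume k: "k \<in> carrier K" and m: "m \<in> carrier Mk" and b: "b \<in> carrier Bk"
  note k' = ring_hom_closed[OF KB.structure_map_hom k]
  show "MC.pt (k \<odot>\<^bsub>Mk\<^esub> m) (b \<odot>\<^bsub>C\<^esub> c) = MC.pt m ((k \<odot>\<^bsub>Bk\<^esub> b) \<odot>\<^bsub>C\<^esub> c)"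
    using MC.pt_balanced[OF k m, of "b \<odot>\<^bsub>C\<^esub> c"] assms b k' by (simp add: C.smult_assoc1)
next
  fix m m' b assume "m \<in> carrier Mk" "m' \<in> carrier Mk" "b \<in> carrier Bk"
  then show "MC.pt (m \<oplus>\<^bsub>Mk\<^esub> m') (b \<odot>\<^bsub>C\<^esub> c) = MC.pt m (b \<odot>\<^bsub>C\<^esub> c) \<oplus>\<^bsub>MC.T\<^esub> MC.pt m' (b \<odot>\<^bsub>C\<^esub> c)"
    using assms MC.pt_add_left[of m m' "b \<odot>\<^bsub>C\<^esub> c"] by simp
next
  fix m b b' assume "m \<in> carrier Mk" "b \<in> carrier Bk" "b' \<in> carrier Bk"
  then show "MC.pt m ((b \<oplus>\<^bsub>Bk\<^esub> b') \<odot>\<^bsub>C\<^esub> c) = MC.pt m (b \<odot>\<^bsub>C\<^esub> c) \<oplus>\<^bsub>MC.T\<^esub> MC.pt m (b' \<odot>\<^bsub>C\<^esub> c)"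
    using assms MC.pt_add_right[of m "b \<odot>\<^bsub>C\<^esub> c" "b' \<odot>\<^bsub>C\<^esub> c"] by (simp add: C.smult_l_distr)
qed (use assms in simp)

lemma act_closed: "\<lbrakk>c \<in> carrier C; x \<in> carrier MB.T\<rbrakk> \<Longrightarrow> act c x \<in> carrier MC.T"
  and act_add: "\<lbrakk>c \<in> carrier C; x \<in> carrier MB.T; y \<in> carrier MB.T\<rbrakk> \<Longrightarrow>
    act c (x \<oplus>\<^bsub>MB.T\<^esub> y) = act c x \<oplus>\<^bsub>MC.T\<^esub> act c y"
  and act_pt: "\<lbrakk>c \<in> carrier C; m \<in> carrier M; b \<in> carrier B\<rbrakk> \<Longrightarrow>
    act c (MB.pt m b) = MC.pt m (b \<odot>\<^bsub>C\<^esub> c)"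
  unfolding act_def using MB.lift[OF MC.T.abelian_group_axioms balanced_smult, of c] by simp_all

text \<open>Additivity in \<open>c\<close> and compatibility with \<open>B\<close> are equations
  between additive functions of \<open>x\<close>, hence are settled on pure tensors, where the
  latter comes from commutativity of \<open>B\<close>.\<close>

lemma balanced_act: "BC.balanced_map MC.T (\<lambda>x c. act c x)"
proof (rule BC.balanced_mapI)
  fix x c c' assume x: "x \<in> carrier PB" and c: "c \<in> carrier C" "c' \<in> carrier C"
  from x have "x \<in> carrier MB.T" by simp
  then show "act (c \<oplus>\<^bsub>C\<^esub> c') x = act c x \<oplus>\<^bsub>MC.T\<^esub> act c' x"
  proof (induction rule: MB.tensor_induct)
    case (pure m b)
    then show ?case
      using c MC.pt_add_right[of m "b \<odot>\<^bsub>C\<^esub> c" "b \<odot>\<^bsub>C\<^esub> c'"] by (simp add: act_pt C.smult_r_distr)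
  next
    case (add x y)
    then show ?case using c by (simp add: act_add act_closed MC.T.a_ac)
  qed
next
  fix b x c assume b: "b \<in> carrier B" and x: "x \<in> carrier PB" and c: "c \<in> carrier C"
  note [simp del] = restrict_scalars_simps(6)
  from x have "x \<in> carrier MB.T" by simp
  then show "act c (b \<odot>\<^bsub>PB\<^esub> x) = act (b \<odot>\<^bsub>C\<^esub> c) x"
  proof (induction rule: MB.tensor_induct)
    case (pure m b')
    then have "(b \<otimes>\<^bsub>B\<^esub> b') \<odot>\<^bsub>C\<^esub> c = b' \<odot>\<^bsub>C\<^esub> (b \<odot>\<^bsub>C\<^esub> c)"
      using b c KB.m_comm[of b b'] by (simp flip: C.smult_assoc1)
    then show ?case using pure b c by (simp add: smult_PB_pt act_pt)
  next
    case (add x y)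
    then show ?case using b c by (simp add: smult_PB_add smult_PB_closed act_add)
  qed
qed (simp_all add: act_closed act_add)

lemma to_fibre_closed: "x \<in> carrier BC.T \<Longrightarrow> to_fibre x \<in> carrier MC.T"
  and to_fibre_add: "\<lbrakk>x \<in> carrier BC.T; y \<in> carrier BC.T\<rbrakk> \<Longrightarrow> to_fibre (x \<oplus>\<^bsub>BC.T\<^esub> y) = to_fibre x \<oplus>\<^bsub>MC.T\<^esub> to_fibre y"
  and to_fibre_pt: "\<lbrakk>z \<in> carrier MB.T; c \<in> carrier C\<rbrakk> \<Longrightarrow> to_fibre (BC.pt z c) = act c z"
  unfolding to_fibre_def using BC.lift[OF MC.T.abelian_group_axioms balanced_act] by simp_all

lemma balanced_from_fibre: "MC.balanced_map BC.T (\<lambda>m c. BC.pt (MB.pt m \<one>\<^bsub>B\<^esub>) c)"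
proof (rule MC.balanced_mapI)
  fix m m' c assume "m \<in> carrier Mk" "m' \<in> carrier Mk" "c \<in> carrier Ck"
  then show "BC.pt (MB.pt (m \<oplus>\<^bsub>Mk\<^esub> m') \<one>\<^bsub>B\<^esub>) c =
      BC.pt (MB.pt m \<one>\<^bsub>B\<^esub>) c \<oplus>\<^bsub>BC.T\<^esub> BC.pt (MB.pt m' \<one>\<^bsub>B\<^esub>) c"
    using BC.pt_add_left[of "MB.pt m \<one>\<^bsub>B\<^esub>" "MB.pt m' \<one>\<^bsub>B\<^esub>" c] MB.pt_add_left[of m m' "\<one>\<^bsub>B\<^esub>"] by simp
next
  fix m c c' assume "m \<in> carrier Mk" "c \<in> carrier Ck" "c' \<in> carrier Ck"
  then show "BC.pt (MB.pt m \<one>\<^bsub>B\<^esub>) (c \<oplus>\<^bsub>Ck\<^esub> c') =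
      BC.pt (MB.pt m \<one>\<^bsub>B\<^esub>) c \<oplus>\<^bsub>BC.T\<^esub> BC.pt (MB.pt m \<one>\<^bsub>B\<^esub>) c'"
    using BC.pt_add_right[of "MB.pt m \<one>\<^bsub>B\<^esub>" c c'] by simp
next
  fix k m c assume k: "k \<in> carrier K" and m: "m \<in> carrier Mk" and c: "c \<in> carrier Ck"
  note k' = ring_hom_closed[OF KB.structure_map_hom k]
  have "MB.pt (k \<odot>\<^bsub>Mk\<^esub> m) \<one>\<^bsub>B\<^esub> = structure_map B k \<odot>\<^bsub>PB\<^esub> MB.pt m \<one>\<^bsub>B\<^esub>"
    using MB.pt_balanced[OF k m, of "\<one>\<^bsub>B\<^esub>"] m k' smult_PB_pt[of "structure_map B k" m "\<one>\<^bsub>B\<^esub>"] by simp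
  then show "BC.pt (MB.pt (k \<odot>\<^bsub>Mk\<^esub> m) \<one>\<^bsub>B\<^esub>) c = BC.pt (MB.pt m \<one>\<^bsub>B\<^esub>) (k \<odot>\<^bsub>Ck\<^esub> c)"
    using BC.pt_balanced[OF k', of "MB.pt m \<one>\<^bsub>B\<^esub>" c] m c by simp
qed simp

lemma from_fibre_closed: "x \<in> carrier MC.T \<Longrightarrow> from_fibre x \<in> carrier BC.T"
  and from_fibre_add: "\<lbrakk>x \<in> carrier MC.T; y \<in> carrier MC.T\<rbrakk> \<Longrightarrow> from_fibre (x \<oplus>\<^bsub>MC.T\<^esub> y) = from_fibre x \<oplus>\<^bsub>BC.T\<^esub> from_fibre y"
  and from_fibre_pt: "\<lbrakk>m \<in> carrier M; c \<in> carrier C\<rbrakk> \<Longrightarrow> from_fibre (MC.pt m c) = BC.pt (MB.pt m \<one>\<^bsub>B\<^esub>) c"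
  unfolding from_fibre_def using MC.lift[OF BC.T.abelian_group_axioms balanced_from_fibre] by simp_all

lemma to_fibre_from_fibre: "x \<in> carrier MC.T \<Longrightarrow> to_fibre (from_fibre x) = x"
  by (induction rule: MC.tensor_induct) (simp_all add: from_fibre_pt to_fibre_pt act_pt from_fibre_add to_fibre_add from_fibre_closed)

text \<open>On pure tensors this is (m \<otimes> b) \<otimes> c = b(m \<otimes> 1) \<otimes> c = (m
  \<otimes> 1) \<otimes> bc. The left factor of a pure tensor over \<open>B\<close> is an arbitrary
  element of M \<otimes> B, whence the second induction.\<close>

lemma from_fibre_to_fibre:
  assumes "x \<in> carrier BC.T"
  shows "from_fibre (to_fibre x) = x"
  using assms
proof (induction rule: BC.tensor_induct)
  case (pure x c)
  then have "x \<in> carrier MB.T" and c: "c \<in> carrier C" by simp_all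
  then have "from_fibre (act c x) = BC.pt x c"
  proof (induction rule: MB.tensor_induct)
    case (pure m b)
    then have "b \<odot>\<^bsub>PB\<^esub> MB.pt m \<one>\<^bsub>B\<^esub> = MB.pt m b" using smult_PB_pt[of b m "\<one>\<^bsub>B\<^esub>"] by simp
    then show ?case
      using pure c BC.pt_balanced[of b "MB.pt m \<one>\<^bsub>B\<^esub>" c] by (simp add: act_pt from_fibre_pt)
  next
    case (add x y)
    then show ?case using c BC.pt_add_left[of x y c] by (simp add: act_add act_closed from_fibre_add)
  qed
  then show ?case using pure to_fibre_pt[of x c] by simp
next
  case (add x y)
  then show ?case using to_fibre_add[of x y] from_fibre_add[of "to_fibre x" "to_fibre y"] to_fibre_closed by simp
qed

lemma inv_into_to_fibre:
  assumes "x \<in> carrier MC.T"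
  shows "inv_into (carrier BC.T) to_fibre x = from_fibre x"
proof (rule inv_into_f_eq)
  show "inj_on to_fibre (carrier BC.T)" by (rule inj_on_inverseI[of _ "from_fibre"]) (rule from_fibre_to_fibre)
qed (use assms in \<open>simp_all add: from_fibre_closed to_fibre_from_fibre\<close>)

text \<open>Here and in \<open>op_at\<close> stand the defining expressions of
  \<open>operator_at\<close> with \<open>C\<close> in place of the residue field, so that the two
  agree by unfolding when \<open>C\<close> is specialised.\<close>

definition "base_change D = tensor_lift (add_monoid BC.T) (\<lambda>x c. BC.pt (D x) c)"

definition "op_at D = to_fibre \<circ> base_change D \<circ> inv_into (carrier BC.T) to_fibre"

context
  fixes D assumes D: "D \<in> module_hom B PB PB"
begin

lemma D_closed: "x \<in> carrier MB.T \<Longrightarrow> D x \<in> carrier MB.T"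
  and D_add: "\<lbrakk>x \<in> carrier MB.T; y \<in> carrier MB.T\<rbrakk> \<Longrightarrow> D (x \<oplus>\<^bsub>MB.T\<^esub> y) = D x \<oplus>\<^bsub>MB.T\<^esub> D y"
  and D_smult: "\<lbrakk>b \<in> carrier B; x \<in> carrier MB.T\<rbrakk> \<Longrightarrow> D (b \<odot>\<^bsub>PB\<^esub> x) = b \<odot>\<^bsub>PB\<^esub> D x"
  using D by (auto simp: module_hom_def)

lemma balanced_base_change: "BC.balanced_map BC.T (\<lambda>x c. BC.pt (D x) c)"
proof (rule BC.balanced_mapI)
  fix x y c assume "x \<in> carrier PB" "y \<in> carrier PB" "c \<in> carrier C"
  then show "BC.pt (D (x \<oplus>\<^bsub>PB\<^esub> y)) c = BC.pt (D x) c \<oplus>\<^bsub>BC.T\<^esub> BC.pt (D y) c"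
    using BC.pt_add_left[of "D x" "D y" c] by (simp add: D_add D_closed)
next
  fix b x c assume "b \<in> carrier B" "x \<in> carrier PB" "c \<in> carrier C"
  then show "BC.pt (D (b \<odot>\<^bsub>PB\<^esub> x)) c = BC.pt (D x) (b \<odot>\<^bsub>C\<^esub> c)"
    using BC.pt_balanced[of b "D x" c] D_smult[of b x] by (simp add: D_closed)
qed (simp_all add: D_closed BC.pt_add_right)

text \<open>The last equation makes the operator computable: the inverse isomorphism sends m
  \<otimes> c to (m \<otimes> 1) \<otimes> c, \<open>D\<close> acts on the left factor, and
  \<open>to_fibre\<close> specialises the result at \<open>c\<close>.\<close>

lemma op_at_closed: "x \<in> carrier MC.T \<Longrightarrow> op_at D x \<in> carrier MC.T"
  and op_at_add: "\<lbrakk>x \<in> carrier MC.T; y \<in> carrier MC.T\<rbrakk> \<Longrightarrow>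
    op_at D (x \<oplus>\<^bsub>MC.T\<^esub> y) = op_at D x \<oplus>\<^bsub>MC.T\<^esub> op_at D y"
  and op_at_pt: "\<lbrakk>m \<in> carrier M; c \<in> carrier C\<rbrakk> \<Longrightarrow>
    op_at D (MC.pt m c) = act c (D (MB.pt m \<one>\<^bsub>B\<^esub>))"
  using BC.lift[OF BC.T.abelian_group_axioms balanced_base_change]
  by (simp_all add: op_at_def base_change_def inv_into_to_fibre from_fibre_closed from_fibre_add from_fibre_pt to_fibre_closed to_fibre_add to_fibre_pt D_closed)

end

end

section \<open>Coordinates with respect to a basis\<close>

text \<open>Basis vectors with their coordinate functionals. The expansion is required over every
  sufficiently large finite index set: expansions of several elements can then be put over one
  common set, and no support has to be named.\<close>

definition dual_basis ::
    "('k, 'y) ring_scheme \<Rightarrow> ('k, 'p, 'x) module_scheme \<Rightarrow> 'i set \<Rightarrow> ('i \<Rightarrow> 'p) \<Rightarrow> ('i \<Rightarrow> 'p \<Rightarrow> 'k) \<Rightarrow> bool"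
  where "dual_basis k P I e \<phi> \<longleftrightarrow>
    (\<forall>i\<in>I. e i \<in> carrier P \<and> \<phi> i \<in> module_hom k P (regular_module k)) \<and>
    (\<forall>i\<in>I. \<forall>j\<in>I. \<phi> i (e j) = (if i = j then \<one>\<^bsub>k\<^esub> else \<zero>\<^bsub>k\<^esub>)) \<and>
    (\<forall>p\<in>carrier P. \<exists>F\<^sub>0. finite F\<^sub>0 \<and> F\<^sub>0 \<subseteq> I \<and> (\<forall>F. finite F \<and> F\<^sub>0 \<subseteq> F \<and> F \<subseteq> I \<longrightarrow>
      finsum P (\<lambda>i. \<phi> i p \<odot>\<^bsub>P\<^esub> e i) F = p))"

lemma (in abelian_monoid) additive_finsum:
  assumes H: "abelian_monoid H"
    and f: "\<And>x. x \<in> carrier G \<Longrightarrow> f x \<in> carrier H" "f \<zero> = \<zero>\<^bsub>H\<^esub>"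
      "\<And>x y. \<lbrakk>x \<in> carrier G; y \<in> carrier G\<rbrakk> \<Longrightarrow> f (x \<oplus> y) = f x \<oplus>\<^bsub>H\<^esub> f y"
    and F: "finite F" "g \<in> F \<rightarrow> carrier G"
  shows "f (finsum G g F) = finsum H (\<lambda>i. f (g i)) F"
proof -
  interpret H: abelian_monoid H by fact
  show ?thesis
    using F
  proof (induction F rule: finite_induct)
    case (insert a F)
    then have "g \<in> F \<rightarrow> carrier G" "(\<lambda>i. f (g i)) \<in> F \<rightarrow> carrier H" using f(1) by auto
    with insert show ?case by (simp add: f)
  qed (simp add: f)
qed

locale based_pair = module_pair k P Q for k (structure) and P Q +
  fixes I :: "'i set" and e \<phi>
  assumes dual_basis: "dual_basis k P I e \<phi>"
begin

lemma e_closed [simp]: "i \<in> I \<Longrightarrow> e i \<in> carrier P"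
  and phi_closed [simp]: "\<lbrakk>i \<in> I; p \<in> carrier P\<rbrakk> \<Longrightarrow> \<phi> i p \<in> carrier k"
  and phi_add: "\<lbrakk>i \<in> I; p \<in> carrier P; p' \<in> carrier P\<rbrakk> \<Longrightarrow> \<phi> i (p \<oplus>\<^bsub>P\<^esub> p') = \<phi> i p \<oplus> \<phi> i p'"
  and phi_smult: "\<lbrakk>i \<in> I; c \<in> carrier k; p \<in> carrier P\<rbrakk> \<Longrightarrow> \<phi> i (c \<odot>\<^bsub>P\<^esub> p) = c \<otimes> \<phi> i p"
  and phi_e: "\<lbrakk>i \<in> I; j \<in> I\<rbrakk> \<Longrightarrow> \<phi> i (e j) = (if i = j then \<one> else \<zero>)"
  using dual_basis by (auto simp: dual_basis_def module_hom_def)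

text \<open>The map \<phi>_i \<otimes> id followed by the isomorphism of k \<otimes> Q with
  \<open>Q\<close>.\<close>

definition "coord i = tensor_lift (add_monoid Q) (\<lambda>p q. \<phi> i p \<odot>\<^bsub>Q\<^esub> q)"

lemma balanced_coord: "i \<in> I \<Longrightarrow> balanced_map Q (\<lambda>p q. \<phi> i p \<odot>\<^bsub>Q\<^esub> q)"
  by (rule balanced_mapI)
    (simp_all add: phi_add phi_smult Q.smult_l_distr Q.smult_r_distr P.m_comm flip: Q.smult_assoc1)

lemma coord_closed [simp]: "\<lbrakk>i \<in> I; x \<in> carrier T\<rbrakk> \<Longrightarrow> coord i x \<in> carrier Q"
  and coord_add: "\<lbrakk>i \<in> I; x \<in> carrier T; y \<in> carrier T\<rbrakk> \<Longrightarrow> coord i (x \<oplus>\<^bsub>T\<^esub> y) = coord i x \<oplus>\<^bsub>Q\<^esub> coord i y"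
  and coord_pt: "\<lbrakk>i \<in> I; p \<in> carrier P; q \<in> carrier Q\<rbrakk> \<Longrightarrow> coord i (pt p q) = \<phi> i p \<odot>\<^bsub>Q\<^esub> q"
  unfolding coord_def using lift[OF Q.abelian_group_axioms balanced_coord, of i] by simp_all

lemma coord_zero [simp]: "i \<in> I \<Longrightarrow> coord i \<zero>\<^bsub>T\<^esub> = \<zero>\<^bsub>Q\<^esub>"
  using coord_add[of i "\<zero>\<^bsub>T\<^esub>" "\<zero>\<^bsub>T\<^esub>"] by simp

lemma coord_pt_e: "\<lbrakk>i \<in> I; j \<in> I; q \<in> carrier Q\<rbrakk> \<Longrightarrow> coord i (pt (e j) q) = (if i = j then q else \<zero>\<^bsub>Q\<^esub>)"
  by (simp add: coord_pt phi_e)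

text \<open>A pure tensor inherits its index set from the expansion of its left factor, as the
  scalars \<phi>_i(p) move across the tensor sign; a sum takes the union of two index sets.\<close>

lemma expansion:
  assumes "x \<in> carrier T"
  shows "\<exists>F\<^sub>0. finite F\<^sub>0 \<and> F\<^sub>0 \<subseteq> I \<and> (\<forall>F. finite F \<and> F\<^sub>0 \<subseteq> F \<and> F \<subseteq> I \<longrightarrow>
    finsum T (\<lambda>i. pt (e i) (coord i x)) F = x)"
  using assms
proof (induction rule: tensor_induct)
  case (pure p q)
  then obtain F\<^sub>0 where F\<^sub>0: "finite F\<^sub>0" "F\<^sub>0 \<subseteq> I"
    and *: "\<And>F. finite F \<and> F\<^sub>0 \<subseteq> F \<and> F \<subseteq> I \<Longrightarrow> finsum P (\<lambda>i. \<phi> i p \<odot>\<^bsub>P\<^esub> e i) F = p"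
    using dual_basis unfolding dual_basis_def by blast
  have "finsum T (\<lambda>i. pt (e i) (coord i (pt p q))) F = pt p q"
    if F: "finite F \<and> F\<^sub>0 \<subseteq> F \<and> F \<subseteq> I" for F
  proof -
    have "pt (finsum P (\<lambda>i. \<phi> i p \<odot>\<^bsub>P\<^esub> e i) F) q = finsum T (\<lambda>i. pt (\<phi> i p \<odot>\<^bsub>P\<^esub> e i) q) F"
      by (rule P.additive_finsum[OF T.abelian_monoid_axioms]) (use F pure in \<open>auto simp: pt_add_left subset_iff\<close>)
    also have "\<dots> = finsum T (\<lambda>i. pt (e i) (coord i (pt p q))) F"
    proof (rule T.finsum_cong')
      fix i assume "i \<in> F"
      then show "pt (\<phi> i p \<odot>\<^bsub>P\<^esub> e i) q = pt (e i) (coord i (pt p q))"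
        using F pure by (subst pt_balanced) (auto simp: coord_pt)
    qed (use F pure in auto)
    finally show ?thesis by (simp only: *[OF F])
  qed
  then show ?case using F\<^sub>0 by blast
next
  case (add x y)
  from add(3) obtain F\<^sub>1 where F\<^sub>1: "finite F\<^sub>1" "F\<^sub>1 \<subseteq> I"
    and x: "\<And>F. finite F \<and> F\<^sub>1 \<subseteq> F \<and> F \<subseteq> I \<Longrightarrow> finsum T (\<lambda>i. pt (e i) (coord i x)) F = x"
    by blast
  from add(4) obtain F\<^sub>2 where F\<^sub>2: "finite F\<^sub>2" "F\<^sub>2 \<subseteq> I"
    and y: "\<And>F. finite F \<and> F\<^sub>2 \<subseteq> F \<and> F \<subseteq> I \<Longrightarrow> finsum T (\<lambda>i. pt (e i) (coord i y)) F = y"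
    by blast
  have "finsum T (\<lambda>i. pt (e i) (coord i (x \<oplus>\<^bsub>T\<^esub> y))) F = x \<oplus>\<^bsub>T\<^esub> y"
    if F: "finite F \<and> F\<^sub>1 \<union> F\<^sub>2 \<subseteq> F \<and> F \<subseteq> I" for F
  proof -
    have "finsum T (\<lambda>i. pt (e i) (coord i (x \<oplus>\<^bsub>T\<^esub> y))) F =
        finsum T (\<lambda>i. pt (e i) (coord i x) \<oplus>\<^bsub>T\<^esub> pt (e i) (coord i y)) F"
      by (rule T.finsum_cong') (use F add(1,2) in \<open>auto simp: coord_add pt_add_right subset_iff\<close>)
    also have "\<dots> = finsum T (\<lambda>i. pt (e i) (coord i x)) F \<oplus>\<^bsub>T\<^esub> finsum T (\<lambda>i. pt (e i) (coord i y)) F"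
      by (rule T.finsum_addf) (use F add(1,2) in \<open>auto simp: subset_iff\<close>)
    also have "\<dots> = x \<oplus>\<^bsub>T\<^esub> y"
      using F by (simp add: x y)
    finally show ?thesis .
  qed
  then show ?case using F\<^sub>1 F\<^sub>2 by (intro exI[of _ "F\<^sub>1 \<union> F\<^sub>2"]) blast
qed

lemma expansion_obtain:
  assumes "x \<in> carrier T"
  obtains F where "finite F" "F \<subseteq> I" "finsum T (\<lambda>i. pt (e i) (coord i x)) F = x"
proof -
  from expansion[OF assms] obtain F where "finite F" "F \<subseteq> I"
    and *: "\<And>F'. finite F' \<and> F \<subseteq> F' \<and> F' \<subseteq> I \<Longrightarrow> finsum T (\<lambda>i. pt (e i) (coord i x)) F' = x"
    by blast
  then show thesis using *[of F] by (intro that[of F]) simp_all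
qed

lemma eq_zeroI:
  assumes "x \<in> carrier T" "\<And>i. i \<in> I \<Longrightarrow> coord i x = \<zero>\<^bsub>Q\<^esub>"
  shows "x = \<zero>\<^bsub>T\<^esub>"
proof -
  obtain F where F: "F \<subseteq> I" "finsum T (\<lambda>i. pt (e i) (coord i x)) F = x"
    using expansion_obtain[OF assms(1)] .
  have "finsum T (\<lambda>i. pt (e i) (coord i x)) F = \<zero>\<^bsub>T\<^esub>"
    by (rule T.finsum_all0) (use F(1) assms(2) pt_zero_right e_closed in \<open>simp add: subset_iff\<close>)
  then show ?thesis by (simp only: F(2))
qed

lemma coord_finsum:
  assumes "finite F" "g \<in> F \<rightarrow> carrier T" "i \<in> I"
  shows "coord i (finsum T g F) = finsum Q (\<lambda>j. coord i (g j)) F"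
  by (rule T.additive_finsum[OF Q.abelian_monoid_axioms]) (use assms in \<open>auto simp: coord_add\<close>)

text \<open>Uniqueness of coefficients, the counterpart of \<open>expansion\<close>: P \<otimes> Q
  is a direct sum of copies of \<open>Q\<close> indexed by \<open>I\<close>.\<close>

lemma coord_combination:
  assumes F: "finite F" "F \<subseteq> I" and c: "c \<in> F \<rightarrow> carrier Q" and i: "i \<in> F"
  shows "coord i (finsum T (\<lambda>j. pt (e j) (c j)) F) = c i"
proof -
  have I: "i \<in> I" using F i by blast
  have "coord i (finsum T (\<lambda>j. pt (e j) (c j)) F) = finsum Q (\<lambda>j. coord i (pt (e j) (c j))) F"
    by (rule coord_finsum) (use F c I in \<open>auto simp: Pi_iff subset_iff\<close>)
  also have "\<dots> = finsum Q (\<lambda>j. if i = j then c j else \<zero>\<^bsub>Q\<^esub>) F"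
    by (rule Q.finsum_cong') (use F c I in \<open>auto simp: coord_pt_e Pi_iff subset_iff\<close>)
  also have "\<dots> = c i"
    by (rule Q.finsum_singleton) (use F c i in \<open>auto simp: Pi_iff subset_iff\<close>)
  finally show ?thesis .
qed

end

section \<open>Independence of columns is an open condition\<close>

text \<open>The arguments of \<open>v\<close> are column, then row; the set of rows may be infinite.
  Entries lie in the base ring and coefficients in the module, so that one matrix can be tested at
  every point. For C = kappa(s) this is linear independence over kappa(s) of the columns reduced
  modulo \<open>s\<close>.\<close>

definition independent_columns ::
    "('b, 'c, 'x) module_scheme \<Rightarrow> 'i set \<Rightarrow> ('j \<Rightarrow> 'i \<Rightarrow> 'b) \<Rightarrow> 'j set \<Rightarrow> bool"
  where "independent_columns C I v F \<longleftrightarrow> (\<forall>c. c \<in> F \<rightarrow> carrier C \<longrightarrow>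
    (\<forall>i\<in>I. finsum C (\<lambda>j. v j i \<odot>\<^bsub>C\<^esub> c j) F = \<zero>\<^bsub>C\<^esub>) \<longrightarrow> (\<forall>j\<in>F. c j = \<zero>\<^bsub>C\<^esub>))"

text \<open>The only properties of $\kappa(s)$ that matter, as a predicate on \<open>B\<close>-modules.\<close>

definition residue_module :: "('b, 'y) ring_scheme \<Rightarrow> 'b set \<Rightarrow> ('b, 'c, 'x) module_scheme \<Rightarrow> bool"
  where "residue_module B s C \<longleftrightarrow> module B C \<and> (\<exists>c\<in>carrier C. c \<noteq> \<zero>\<^bsub>C\<^esub>) \<and>
    (\<forall>b\<in>carrier B. \<forall>c\<in>carrier C. b \<odot>\<^bsub>C\<^esub> c = \<zero>\<^bsub>C\<^esub> \<longleftrightarrow> b \<in> s \<or> c = \<zero>\<^bsub>C\<^esub>)"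

text \<open>Primality of \<open>s\<close> is recovered from the module: for c \<noteq> 0, ab
  \<notin> s means a(bc) \<noteq> 0, which holds exactly if \<open>a\<close> and \<open>b\<close>
  are both outside \<open>s\<close>. It lets pivots be collected in one product.\<close>

lemma residue_module_mult_notin:
  assumes "residue_module B s C" "a \<in> carrier B" "b \<in> carrier B"
  shows "a \<otimes>\<^bsub>B\<^esub> b \<notin> s \<longleftrightarrow> a \<notin> s \<and> b \<notin> s"
proof -
  interpret module B C using assms by (simp add: residue_module_def)
  obtain c where "c \<in> carrier C" "c \<noteq> \<zero>\<^bsub>C\<^esub>" using assms by (auto simp: residue_module_def)
  then show ?thesis
    using assms smult_assoc1[of a b c] unfolding residue_module_def by (metis R.m_closed smult_closed)
qed

text \<open>The row operation in module form: \<open>a\<close> is the pivot, \<open>u\<close> the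
  pivot row, \<open>x\<close> the entry of the pivot column in row \<open>w\<close>. The reduced row
  a w - x u, applied to \<open>c\<close>, is row \<open>w\<close> applied to the scaled coefficients
  a c, minus \<open>x\<close> times the pivot row applied to \<open>c\<close>.\<close>

lemma (in module) finsum_elimination:
  assumes "finite F" "c \<in> F \<rightarrow> carrier M" "a \<in> carrier R" "x \<in> carrier R"
    "\<And>j. j \<in> F \<Longrightarrow> u j \<in> carrier R" "\<And>j. j \<in> F \<Longrightarrow> w j \<in> carrier R"
  shows "finsum M (\<lambda>j. (a \<otimes> w j \<ominus> u j \<otimes> x) \<odot>\<^bsub>M\<^esub> c j) F =
    finsum M (\<lambda>j. w j \<odot>\<^bsub>M\<^esub> (a \<odot>\<^bsub>M\<^esub> c j)) F \<ominus>\<^bsub>M\<^esub> x \<odot>\<^bsub>M\<^esub> finsum M (\<lambda>j. u j \<odot>\<^bsub>M\<^esub> c j) F"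
proof -
  have cM: "c j \<in> carrier M" if "j \<in> F" for j using assms(2) that by blast
  have "finsum M (\<lambda>j. (a \<otimes> w j \<ominus> u j \<otimes> x) \<odot>\<^bsub>M\<^esub> c j) F =
      finsum M (\<lambda>j. w j \<odot>\<^bsub>M\<^esub> (a \<odot>\<^bsub>M\<^esub> c j) \<oplus>\<^bsub>M\<^esub> (\<ominus> x) \<odot>\<^bsub>M\<^esub> (u j \<odot>\<^bsub>M\<^esub> c j)) F"
  proof (rule M.finsum_cong')
    fix j assume j: "j \<in> F"
    then have cl: "c j \<in> carrier M" "u j \<in> carrier R" "w j \<in> carrier R" using assms by auto
    have "a \<otimes> w j \<ominus> u j \<otimes> x = w j \<otimes> a \<oplus> (\<ominus> x) \<otimes> u j"
      using cl assms R.m_comm[of "w j" a] R.m_comm[of "u j" x] by (simp add: R.minus_eq R.l_minus)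
    then show "(a \<otimes> w j \<ominus> u j \<otimes> x) \<odot>\<^bsub>M\<^esub> c j = w j \<odot>\<^bsub>M\<^esub> (a \<odot>\<^bsub>M\<^esub> c j) \<oplus>\<^bsub>M\<^esub> (\<ominus> x) \<odot>\<^bsub>M\<^esub> (u j \<odot>\<^bsub>M\<^esub> c j)"
      using cl assms(3,4) by (simp add: smult_l_distr smult_assoc1)
  qed (use cM assms(1,3-) in auto)
  also have "\<dots> = finsum M (\<lambda>j. w j \<odot>\<^bsub>M\<^esub> (a \<odot>\<^bsub>M\<^esub> c j)) F \<oplus>\<^bsub>M\<^esub> finsum M (\<lambda>j. (\<ominus> x) \<odot>\<^bsub>M\<^esub> (u j \<odot>\<^bsub>M\<^esub> c j)) F"
    by (rule M.finsum_addf) (use cM assms(1,3-) in auto)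
  also have "finsum M (\<lambda>j. (\<ominus> x) \<odot>\<^bsub>M\<^esub> (u j \<odot>\<^bsub>M\<^esub> c j)) F = (\<ominus> x) \<odot>\<^bsub>M\<^esub> finsum M (\<lambda>j. u j \<odot>\<^bsub>M\<^esub> c j) F"
    by (rule finsum_smult_ldistr[symmetric]) (use cM assms(1,3-) in auto)
  also have "\<dots> = \<ominus>\<^bsub>M\<^esub> (x \<odot>\<^bsub>M\<^esub> finsum M (\<lambda>j. u j \<odot>\<^bsub>M\<^esub> c j) F)"
    by (rule smult_l_minus) (use cM assms(1,3-) in \<open>auto intro!: M.finsum_closed\<close>)
  finally show ?thesis by (simp add: M.minus_eq)
qed

text \<open>If all of column \<open>p\<close> lay in \<open>s\<close>, a non-zero element as its
  coefficient, with zero for the other columns, would be a non-trivial relation. This supplies the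
  pivot.\<close>

lemma (in module) nonzero_column_entry:
  assumes F: "finite F" "p \<in> F" and v: "\<And>j i. \<lbrakk>j \<in> F; i \<in> I\<rbrakk> \<Longrightarrow> v j i \<in> carrier R"
    and res: "residue_module R s M" and ind: "independent_columns M I v F"
  shows "\<exists>i\<in>I. v p i \<notin> s"
proof (rule ccontr)
  assume no: "\<not> ?thesis"
  obtain c where c: "c \<in> carrier M" "c \<noteq> \<zero>\<^bsub>M\<^esub>" using res by (auto simp: residue_module_def)
  define d where "d j = (if j = p then c else \<zero>\<^bsub>M\<^esub>)" for j
  have "finsum M (\<lambda>j. v j i \<odot>\<^bsub>M\<^esub> d j) F = \<zero>\<^bsub>M\<^esub>" if "i \<in> I" for i
  proof (rule M.finsum_all0)
    fix j assume "j \<in> F"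
    then show "v j i \<odot>\<^bsub>M\<^esub> d j = \<zero>\<^bsub>M\<^esub>"
      using no that res v[of j i] c by (auto simp: d_def residue_module_def)
  qed
  moreover have "d \<in> F \<rightarrow> carrier M" using c by (simp add: d_def)
  ultimately have "d p = \<zero>\<^bsub>M\<^esub>" using ind F(2) unfolding independent_columns_def by blast
  then show False using c by (simp add: d_def)
qed

text \<open>One step of fraction-free Gaussian elimination with the pivot \<open>v p q\<close>.\<close>

lemma (in module) independent_columns_insert_iff:
  assumes F: "finite F" "p \<notin> F" and v: "\<And>j i. \<lbrakk>j \<in> insert p F; i \<in> I\<rbrakk> \<Longrightarrow> v j i \<in> carrier R"
    and res: "residue_module R s M" and q: "q \<in> I" "v p q \<notin> s"
  shows "independent_columns M I v (insert p F) \<longleftrightarrow>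
    independent_columns M I (\<lambda>j i. v p q \<otimes> v j i \<ominus> v j q \<otimes> v p i) F" (is "_ \<longleftrightarrow> independent_columns M I ?w F")
proof -
  have elim: "finsum M (\<lambda>j. ?w j i \<odot>\<^bsub>M\<^esub> c j) F = finsum M (\<lambda>j. v j i \<odot>\<^bsub>M\<^esub> (v p q \<odot>\<^bsub>M\<^esub> c j)) F
      \<ominus>\<^bsub>M\<^esub> v p i \<odot>\<^bsub>M\<^esub> finsum M (\<lambda>j. v j q \<odot>\<^bsub>M\<^esub> c j) F" if "c \<in> F \<rightarrow> carrier M" "i \<in> I" for c i
    by (rule finsum_elimination) (use F v q that in auto)
  have cl: "finsum M (\<lambda>j. v j i \<odot>\<^bsub>M\<^esub> c j) F \<in> carrier M" if "c \<in> F \<rightarrow> carrier M" "i \<in> I" for c i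
    using that v by (intro M.finsum_closed) auto
  have ins: "finsum M (\<lambda>j. v j i \<odot>\<^bsub>M\<^esub> c j) (insert p F) = v p i \<odot>\<^bsub>M\<^esub> c p \<oplus>\<^bsub>M\<^esub> finsum M (\<lambda>j. v j i \<odot>\<^bsub>M\<^esub> c j) F"
    if "c \<in> insert p F \<rightarrow> carrier M" "i \<in> I" for c i
    using that v F by (intro M.finsum_insert) auto
  have inj: "x = \<zero>\<^bsub>M\<^esub>" if "v p q \<odot>\<^bsub>M\<^esub> x = \<zero>\<^bsub>M\<^esub>" "x \<in> carrier M" for x
    using that res q v[of p q] by (auto simp: residue_module_def)
  show ?thesis
  proof
    assume ind: "independent_columns M I v (insert p F)"
    show "independent_columns M I ?w F"
      unfolding independent_columns_def
    proof (intro allI impI ballI)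
      fix c j assume c: "c \<in> F \<rightarrow> carrier M" and j: "j \<in> F"
        and rel: "\<forall>i\<in>I. finsum M (\<lambda>j. ?w j i \<odot>\<^bsub>M\<^esub> c j) F = \<zero>\<^bsub>M\<^esub>"
      \<comment> \<open>Lifts a relation of the reduced columns without division: it is multiplied
        by the pivot \<open>v p q\<close>, and the coefficient of column \<open>p\<close> is chosen
        so that row \<open>q\<close> cancels.\<close>
      define d where "d j = (if j = p then \<ominus>\<^bsub>M\<^esub> finsum M (\<lambda>j. v j q \<odot>\<^bsub>M\<^esub> c j) F else v p q \<odot>\<^bsub>M\<^esub> c j)" for j
      have d: "d \<in> insert p F \<rightarrow> carrier M"
        using c cl[OF c q(1)] v[of p q] q(1) by (auto simp: d_def Pi_iff)
      have "finsum M (\<lambda>j. v j i \<odot>\<^bsub>M\<^esub> d j) (insert p F) = \<zero>\<^bsub>M\<^esub>" if i: "i \<in> I" for i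
      proof -
        have vc: "(\<lambda>j. v p q \<odot>\<^bsub>M\<^esub> c j) \<in> F \<rightarrow> carrier M" using c v[of p q] q by auto
        have "finsum M (\<lambda>j. v j i \<odot>\<^bsub>M\<^esub> d j) F = finsum M (\<lambda>j. v j i \<odot>\<^bsub>M\<^esub> (v p q \<odot>\<^bsub>M\<^esub> c j)) F"
        proof (rule M.finsum_cong')
          show "(\<lambda>j. v j i \<odot>\<^bsub>M\<^esub> (v p q \<odot>\<^bsub>M\<^esub> c j)) \<in> F \<rightarrow> carrier M"
            using vc v i by (auto simp: Pi_iff)
        qed (use F in \<open>auto simp: d_def\<close>)
        moreover have "v p i \<odot>\<^bsub>M\<^esub> d p = \<ominus>\<^bsub>M\<^esub> (v p i \<odot>\<^bsub>M\<^esub> finsum M (\<lambda>j. v j q \<odot>\<^bsub>M\<^esub> c j) F)"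
          using cl[OF c q(1)] v[of p i] i by (simp add: d_def smult_r_minus)
        ultimately have "finsum M (\<lambda>j. v j i \<odot>\<^bsub>M\<^esub> d j) (insert p F) =
            \<ominus>\<^bsub>M\<^esub> (v p i \<odot>\<^bsub>M\<^esub> finsum M (\<lambda>j. v j q \<odot>\<^bsub>M\<^esub> c j) F)
            \<oplus>\<^bsub>M\<^esub> finsum M (\<lambda>j. v j i \<odot>\<^bsub>M\<^esub> (v p q \<odot>\<^bsub>M\<^esub> c j)) F"
          using ins[OF d i] by (simp only:)
        also have "\<dots> = finsum M (\<lambda>j. ?w j i \<odot>\<^bsub>M\<^esub> c j) F"
          unfolding elim[OF c i] M.minus_eq
          by (rule M.a_comm) (use cl[OF c q(1)] cl[OF vc i] v[of p i] i in simp_all)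
        also have "\<dots> = \<zero>\<^bsub>M\<^esub>" using rel i by blast
        finally show ?thesis .
      qed
      then have "d j = \<zero>\<^bsub>M\<^esub>" using ind d j unfolding independent_columns_def by blast
      \<comment> \<open>The factor \<open>v p q\<close> introduced in \<open>d\<close> acts
        injectively, being outside \<open>s\<close>.\<close>
      then show "c j = \<zero>\<^bsub>M\<^esub>" using j F c inj by (auto simp: d_def split: if_splits)
    qed
  next
    assume ind: "independent_columns M I ?w F"
    show "independent_columns M I v (insert p F)"
      unfolding independent_columns_def
    proof (intro allI impI)
      fix c assume c: "c \<in> insert p F \<rightarrow> carrier M"
        and rel: "\<forall>i\<in>I. finsum M (\<lambda>j. v j i \<odot>\<^bsub>M\<^esub> c j) (insert p F) = \<zero>\<^bsub>M\<^esub>"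
      then have c': "c \<in> F \<rightarrow> carrier M" "c p \<in> carrier M" by auto
      \<comment> \<open>Row \<open>i\<close> solved for its part over \<open>F\<close>. With it,
        both terms of the reduced row become multiples of \<open>c p\<close> and cancel.\<close>
      have sum: "finsum M (\<lambda>j. v j i \<odot>\<^bsub>M\<^esub> c j) F = \<ominus>\<^bsub>M\<^esub> (v p i \<odot>\<^bsub>M\<^esub> c p)" if i: "i \<in> I" for i
      proof (rule M.minus_equality[symmetric])
        have "finsum M (\<lambda>j. v j i \<odot>\<^bsub>M\<^esub> c j) F \<oplus>\<^bsub>M\<^esub> v p i \<odot>\<^bsub>M\<^esub> c p = finsum M (\<lambda>j. v j i \<odot>\<^bsub>M\<^esub> c j) (insert p F)"
          unfolding ins[OF c i] by (rule M.a_comm) (use cl[OF c'(1) i] c' v[of p i] i in simp_all)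
        then show "finsum M (\<lambda>j. v j i \<odot>\<^bsub>M\<^esub> c j) F \<oplus>\<^bsub>M\<^esub> v p i \<odot>\<^bsub>M\<^esub> c p = \<zero>\<^bsub>M\<^esub>"
          using rel i by simp
      qed (use cl[OF c'(1) i] c' v[of p i] i in simp_all)
      have "finsum M (\<lambda>j. ?w j i \<odot>\<^bsub>M\<^esub> c j) F = \<zero>\<^bsub>M\<^esub>" if i: "i \<in> I" for i
      proof -
        have vv: "v p q \<in> carrier R" "v p i \<in> carrier R" using v q i by auto
        have "finsum M (\<lambda>j. v j i \<odot>\<^bsub>M\<^esub> (v p q \<odot>\<^bsub>M\<^esub> c j)) F = finsum M (\<lambda>j. v p q \<odot>\<^bsub>M\<^esub> (v j i \<odot>\<^bsub>M\<^esub> c j)) F"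
        proof (rule M.finsum_cong')
          fix j assume "j \<in> F"
          then have "c j \<in> carrier M" "v j i \<in> carrier R" using c' v i by auto
          then show "v j i \<odot>\<^bsub>M\<^esub> (v p q \<odot>\<^bsub>M\<^esub> c j) = v p q \<odot>\<^bsub>M\<^esub> (v j i \<odot>\<^bsub>M\<^esub> c j)"
            using vv by (metis R.m_comm smult_assoc1)
        qed (use c' v i vv in \<open>auto simp: Pi_iff\<close>)
        also have "\<dots> = v p q \<odot>\<^bsub>M\<^esub> finsum M (\<lambda>j. v j i \<odot>\<^bsub>M\<^esub> c j) F"
          by (rule finsum_smult_ldistr[symmetric]) (use F c' v i vv in \<open>auto simp: Pi_iff\<close>)
        also have "\<dots> = \<ominus>\<^bsub>M\<^esub> (v p i \<odot>\<^bsub>M\<^esub> (v p q \<odot>\<^bsub>M\<^esub> c p))"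
          using vv c' by (simp add: sum i smult_r_minus R.m_comm flip: smult_assoc1)
        finally show ?thesis
          using vv c' by (simp add: elim[OF c'(1) i] sum q smult_r_minus M.minus_eq M.l_neg)
      qed
      then have cj: "\<forall>j\<in>F. c j = \<zero>\<^bsub>M\<^esub>" using ind c' unfolding independent_columns_def by blast
      \<comment> \<open>Row \<open>q\<close> is left with the pivot term alone, which forces
        \<open>c p\<close> to vanish.\<close>
      have "finsum M (\<lambda>j. v j q \<odot>\<^bsub>M\<^esub> c j) F = \<zero>\<^bsub>M\<^esub>"
        by (rule M.finsum_all0) (use cj v q in auto)
      then have "v p q \<odot>\<^bsub>M\<^esub> c p = \<zero>\<^bsub>M\<^esub>"
        using rel q ins[OF c q(1)] c' v[of p q] by simp
      then have "c p = \<zero>\<^bsub>M\<^esub>" using inj c' by blast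
      then show "\<forall>j\<in>insert p F. c j = \<zero>\<^bsub>M\<^esub>" using cj by simp
    qed
  qed
qed

text \<open>The element \<open>f\<close> is the product of the pivots met while the columns are
  eliminated at \<open>s\<^sub>0\<close>. If f \<notin> s, none of them lies in \<open>s\<close>, so
  the same eliminations are equivalences at \<open>s\<close> and lead back to the empty set of
  columns. Elimination changes the matrix, hence the induction over arbitrary \<open>v\<close>. All
  modules \<open>C\<close> have one type, as the residue fields of one ring do.\<close>

lemma independent_columns_open:
  fixes C\<^sub>0 :: "('b, 'c, 'x) module_scheme"
  assumes "finite F" "\<And>j i. \<lbrakk>j \<in> F; i \<in> I\<rbrakk> \<Longrightarrow> v j i \<in> carrier B"
    and "residue_module B s\<^sub>0 C\<^sub>0" "independent_columns C\<^sub>0 I v F"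
  shows "\<exists>f\<in>carrier B - s\<^sub>0. \<forall>s (C :: ('b, 'c, 'x) module_scheme).
    residue_module B s C \<and> f \<notin> s \<longrightarrow> independent_columns C I v F"
  using assms
proof (induction F arbitrary: v rule: finite_induct)
  case empty
  interpret module B C\<^sub>0 using empty by (simp add: residue_module_def)
  obtain c where c: "c \<in> carrier C\<^sub>0" "c \<noteq> \<zero>\<^bsub>C\<^sub>0\<^esub>" using empty(2) by (auto simp: residue_module_def)
  \<comment> \<open>The empty product of pivots is 1, which is outside \<open>s\<^sub>0\<close>
    because it acts as the identity on a non-zero module.\<close>
  then have "\<one>\<^bsub>B\<^esub> \<odot>\<^bsub>C\<^sub>0\<^esub> c \<noteq> \<zero>\<^bsub>C\<^sub>0\<^esub>" by simp
  then have "\<one>\<^bsub>B\<^esub> \<in> carrier B - s\<^sub>0" using empty(2) c(1) R.one_closed unfolding residue_module_def by blast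
  then show ?case by (auto simp: independent_columns_def)
next
  case (insert p F)
  interpret C\<^sub>0: module B C\<^sub>0 using insert.prems by (simp add: residue_module_def)
  obtain q where q: "q \<in> I" "v p q \<notin> s\<^sub>0"
    using C\<^sub>0.nonzero_column_entry[of "insert p F" p I v s\<^sub>0] insert by auto
  let ?w = "\<lambda>j i. v p q \<otimes>\<^bsub>B\<^esub> v j i \<ominus>\<^bsub>B\<^esub> v j q \<otimes>\<^bsub>B\<^esub> v p i"
  have "independent_columns C\<^sub>0 I ?w F"
    using C\<^sub>0.independent_columns_insert_iff[of F p I v s\<^sub>0 q] insert q by blast
  moreover have "\<And>j i. \<lbrakk>j \<in> F; i \<in> I\<rbrakk> \<Longrightarrow> ?w j i \<in> carrier B"
    using insert.prems(1) q by (intro C\<^sub>0.R.minus_closed C\<^sub>0.R.m_closed) auto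
  ultimately obtain f where f: "f \<in> carrier B - s\<^sub>0"
    "\<And>s (C :: ('b, 'c, 'x) module_scheme). residue_module B s C \<and> f \<notin> s \<Longrightarrow> independent_columns C I ?w F"
    using insert.IH[of ?w] insert.prems(2) by blast
  have a: "v p q \<in> carrier B" using insert.prems(1) q by simp
  have "v p q \<otimes>\<^bsub>B\<^esub> f \<in> carrier B - s\<^sub>0"
    using residue_module_mult_notin[OF insert.prems(2) a, of f] f(1) a q by auto
  moreover have "independent_columns C I v (insert p F)"
    if C: "residue_module B s C" "v p q \<otimes>\<^bsub>B\<^esub> f \<notin> s" for s and C :: "('b, 'c, 'x) module_scheme"
  proof -
    interpret C: module B C using C by (simp add: residue_module_def)
    have "v p q \<notin> s" "f \<notin> s" using residue_module_mult_notin[OF C(1) a, of f] f(1) C(2) by auto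
    then show ?thesis
      using C.independent_columns_insert_iff[of F p I v s q] insert(1,2) insert.prems(1) C q f(2)[of s C] by blast
  qed
  ultimately show ?case by blast
qed

section \<open>The matrix of a family and of its base changes\<close>

locale based_family = family K A B M for K A B M +
  fixes I :: "'i set" and e \<phi>
  assumes basis: "dual_basis K Mk I e \<phi>"
begin

sublocale MBI: based_pair K Mk Bk I e \<phi>
  by (intro based_pair.intro MB.module_pair_axioms based_pair_axioms.intro basis)

definition "entry D j i = MBI.coord i (D (MB.pt (e j) \<one>\<^bsub>B\<^esub>))"

end

locale based_family_fibre = based_family K A B M I e \<phi> + family_fibre K A B M C for K A B M C I e \<phi>
begin

sublocale MCI: based_pair K Mk Ck I e \<phi>
  by (intro based_pair.intro MC.module_pair_axioms based_pair_axioms.intro basis)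

text \<open>This is why the operator on the fibre has the same matrix over \<open>B\<close>, now
  acting on \<open>C\<close>. Both sides are additive in \<open>z\<close> and agree on pure tensors
  by associativity of the action.\<close>

lemma coord_act:
  assumes "i \<in> I" "c \<in> carrier C" "z \<in> carrier MB.T"
  shows "MCI.coord i (act c z) = MBI.coord i z \<odot>\<^bsub>C\<^esub> c"
  using assms(3)
proof (induction rule: MB.tensor_induct)
  case (pure m b)
  then have "\<phi> i m \<in> carrier K" using assms(1) MBI.phi_closed by simp
  note k' = ring_hom_closed[OF KB.structure_map_hom this]
  show ?case
    using pure assms(1,2) k' by (simp add: act_pt MCI.coord_pt MBI.coord_pt C.smult_assoc1)
next
  case (add x y)
  have "MBI.coord i x \<in> carrier B" "MBI.coord i y \<in> carrier B"
    using add assms(1) MBI.coord_closed by force+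
  then show ?case
    using add assms(1,2) by (simp add: act_add act_closed MCI.coord_add MBI.coord_add C.smult_l_distr)
qed

text \<open>An element of M \<otimes> C has finitely many non-zero coordinates, so an element of the
  kernel is the same as a relation between finitely many columns. The rows of the relation are the
  coordinates of the image, which together detect zero.\<close>

lemma kernel_zero_iff:
  assumes D: "D \<in> module_hom B PB PB"
  shows "a_kernel MC.T MC.T (op_at D) = {\<zero>\<^bsub>MC.T\<^esub>} \<longleftrightarrow>
    (\<forall>F. finite F \<and> F \<subseteq> I \<longrightarrow> independent_columns C I (entry D) F)"
proof -
  note cl = op_at_closed[OF D] and ad = op_at_add[OF D]
  have zero: "op_at D \<zero>\<^bsub>MC.T\<^esub> = \<zero>\<^bsub>MC.T\<^esub>"
    using ad[of "\<zero>\<^bsub>MC.T\<^esub>" "\<zero>\<^bsub>MC.T\<^esub>"] cl[of "\<zero>\<^bsub>MC.T\<^esub>"] by simp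
  have entry: "entry D j i \<in> carrier B" if "i \<in> I" "j \<in> I" for i j
    using MBI.coord_closed[OF that(1), of "D (MB.pt (e j) \<one>\<^bsub>B\<^esub>)"] that MBI.e_closed
    by (simp add: entry_def D_closed[OF D])
  \<comment> \<open>Row \<open>i\<close> of the matrix times the coefficient vector
    \<open>c\<close>.\<close>
  have op: "MCI.coord i (op_at D (finsum MC.T (\<lambda>j. MC.pt (e j) (c j)) F)) =
      finsum C (\<lambda>j. entry D j i \<odot>\<^bsub>C\<^esub> c j) F"
    if F: "finite F" "F \<subseteq> I" and c: "c \<in> F \<rightarrow> carrier C" and i: "i \<in> I" for F c i
  proof -
    have pc: "MC.pt (e j) (c j) \<in> carrier MC.T" if "j \<in> F" for j
      using that F c MBI.e_closed by (intro MC.pt_closed) auto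
    have "op_at D (finsum MC.T (\<lambda>j. MC.pt (e j) (c j)) F) = finsum MC.T (\<lambda>j. op_at D (MC.pt (e j) (c j))) F"
      by (rule MC.T.additive_finsum[OF MC.T.abelian_monoid_axioms]) (use F pc cl ad zero in auto)
    also have "MCI.coord i \<dots> = finsum Ck (\<lambda>j. MCI.coord i (op_at D (MC.pt (e j) (c j)))) F"
      by (rule MCI.coord_finsum) (use F pc cl i in auto)
    also have "\<dots> = finsum Ck (\<lambda>j. entry D j i \<odot>\<^bsub>C\<^esub> c j) F"
    proof (rule MC.Q.finsum_cong')
      fix j assume j: "j \<in> F"
      then have "j \<in> I" "e j \<in> carrier M" "c j \<in> carrier C" using F c MBI.e_closed by auto
      then show "MCI.coord i (op_at D (MC.pt (e j) (c j))) = entry D j i \<odot>\<^bsub>C\<^esub> c j"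
        using i by (simp add: op_at_pt[OF D] coord_act D_closed[OF D] entry_def)
    qed (use entry c i F in \<open>auto simp: Pi_iff subset_iff\<close>)
    \<comment> \<open>\<open>Ck\<close> and \<open>C\<close> differ in their scalars, which sums do
      not see.\<close>
    also have "\<dots> = finsum C (\<lambda>j. entry D j i \<odot>\<^bsub>C\<^esub> c j) F"
      by (simp add: finsum_def finprod_def)
    finally show ?thesis .
  qed
  show ?thesis
  proof (intro iffI allI impI)
    fix F assume ker: "a_kernel MC.T MC.T (op_at D) = {\<zero>\<^bsub>MC.T\<^esub>}" and F: "finite F \<and> F \<subseteq> I"
    show "independent_columns C I (entry D) F"
      unfolding independent_columns_def
    proof (intro allI impI ballI)
      fix c j assume c: "c \<in> F \<rightarrow> carrier C" and rel: "\<forall>i\<in>I. finsum C (\<lambda>j. entry D j i \<odot>\<^bsub>C\<^esub> c j) F = \<zero>\<^bsub>C\<^esub>"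
        and j: "j \<in> F"
      let ?x = "finsum MC.T (\<lambda>j. MC.pt (e j) (c j)) F"
      have x: "?x \<in> carrier MC.T"
        using F c MBI.e_closed by (intro MC.T.finsum_closed Pi_I MC.pt_closed) auto
      have "op_at D ?x = \<zero>\<^bsub>MC.T\<^esub>"
        by (rule MCI.eq_zeroI[OF cl[OF x]]) (use op F c rel in simp)
      then have "?x = \<zero>\<^bsub>MC.T\<^esub>" using ker x by (auto simp: a_kernel_def')
      then show "c j = \<zero>\<^bsub>C\<^esub>"
        using MCI.coord_combination[of F c j] F c j MCI.coord_zero[of j] by auto
    qed
  next
    assume ind: "\<forall>F. finite F \<and> F \<subseteq> I \<longrightarrow> independent_columns C I (entry D) F"
    have "x = \<zero>\<^bsub>MC.T\<^esub>" if x: "x \<in> carrier MC.T" and ker: "op_at D x = \<zero>\<^bsub>MC.T\<^esub>" for x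
    proof -
      obtain F where F: "finite F" "F \<subseteq> I" "finsum MC.T (\<lambda>i. MC.pt (e i) (MCI.coord i x)) F = x"
        using MCI.expansion_obtain[OF x] .
      have c: "(\<lambda>j. MCI.coord j x) \<in> F \<rightarrow> carrier C" using F x MCI.coord_closed by auto
      have "\<forall>j\<in>F. MCI.coord j x = \<zero>\<^bsub>C\<^esub>"
      proof -
        have "\<forall>i\<in>I. finsum C (\<lambda>j. entry D j i \<odot>\<^bsub>C\<^esub> MCI.coord j x) F = \<zero>\<^bsub>C\<^esub>"
          using op[OF F(1,2) c] ker MCI.coord_zero unfolding F(3) by simp
        moreover have "independent_columns C I (entry D) F" using ind F(1,2) by blast
        ultimately show ?thesis using c unfolding independent_columns_def by blast
      qed
      then have "finsum MC.T (\<lambda>i. MC.pt (e i) (MCI.coord i x)) F = \<zero>\<^bsub>MC.T\<^esub>"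
        using F(2) MC.pt_zero_right MBI.e_closed
        by (intro MC.T.finsum_all0) (simp add: subset_iff)
      then show ?thesis by (simp only: F(3))
    qed
    then show "a_kernel MC.T MC.T (op_at D) = {\<zero>\<^bsub>MC.T\<^esub>}"
      using zero by (auto simp: a_kernel_def')
  qed
qed

end

section \<open>Residue fields\<close>

text \<open>The operations of \<open>fraction_field\<close> are unions over all pairs of
  representatives; such a union is a single fraction once all pairs agree and at least one pair
  exists.\<close>

lemma UN_pairs_const:
  assumes "(a, b) \<in> X" "(c, d) \<in> Y" "\<And>a b c d. \<lbrakk>(a, b) \<in> X; (c, d) \<in> Y\<rbrakk> \<Longrightarrow> f a b c d = Z"
  shows "(\<Union>(a, b)\<in>X. \<Union>(c, d)\<in>Y. f a b c d) = Z"
proof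
  show "(\<Union>(a, b)\<in>X. \<Union>(c, d)\<in>Y. f a b c d) \<subseteq> Z" using assms(3) by blast
  show "Z \<subseteq> (\<Union>(a, b)\<in>X. \<Union>(c, d)\<in>Y. f a b c d)"
  proof
    fix z assume "z \<in> Z"
    then have "z \<in> f a b c d" using assms(3)[OF assms(1,2)] by simp
    then show "z \<in> (\<Union>(a, b)\<in>X. \<Union>(c, d)\<in>Y. f a b c d)"
      using assms(1,2) by (intro UN_I[of "(a, b)"]) auto
  qed
qed

text \<open>A pair (x, y) passes from one class to the other by multiplying with \<open>d\<close>,
  substituting ad = cb and cancelling \<open>b\<close>; both denominators are non-zero in a
  domain.\<close>

lemma (in domain) fraction_eqI:
  assumes "a \<in> carrier R" "b \<in> carrier R - {\<zero>}" "c \<in> carrier R" "d \<in> carrier R - {\<zero>}" "a \<otimes> d = c \<otimes> b"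
  shows "fraction R a b = fraction R c d"
proof -
  have "a \<otimes> y = x \<otimes> b \<longleftrightarrow> c \<otimes> y = x \<otimes> d" if x: "x \<in> carrier R" and y: "y \<in> carrier R" for x y
  proof -
    have cl: "a \<in> carrier R" "b \<in> carrier R" "c \<in> carrier R" "d \<in> carrier R" using assms by auto
    have "a \<otimes> y = x \<otimes> b \<longleftrightarrow> (a \<otimes> y) \<otimes> d = (x \<otimes> b) \<otimes> d"
      using m_rcancel[of d "a \<otimes> y" "x \<otimes> b"] assms cl x y by simp
    also have "(a \<otimes> y) \<otimes> d = (c \<otimes> y) \<otimes> b"
    proof -
      have "(a \<otimes> y) \<otimes> d = (a \<otimes> d) \<otimes> y" using cl x y by algebra
      also have "\<dots> = (c \<otimes> b) \<otimes> y" using assms(5) by simp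
      also have "\<dots> = (c \<otimes> y) \<otimes> b" using cl x y by algebra
      finally show ?thesis .
    qed
    also have "(x \<otimes> b) \<otimes> d = (x \<otimes> d) \<otimes> b" using cl x y by algebra
    also have "(c \<otimes> y) \<otimes> b = (x \<otimes> d) \<otimes> b \<longleftrightarrow> c \<otimes> y = x \<otimes> d"
      using m_rcancel[of b "c \<otimes> y" "x \<otimes> d"] assms cl x y by simp
    finally show ?thesis .
  qed
  then show ?thesis unfolding fraction_def by auto
qed

lemma (in domain) fraction_eq_iff:
  assumes "a \<in> carrier R" "b \<in> carrier R - {\<zero>}" "c \<in> carrier R" "d \<in> carrier R - {\<zero>}"
  shows "fraction R a b = fraction R c d \<longleftrightarrow> a \<otimes> d = c \<otimes> b"
proof
  assume "fraction R a b = fraction R c d"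
  moreover have "(c, d) \<in> fraction R c d" using assms by (simp add: fraction_def)
  ultimately show "a \<otimes> d = c \<otimes> b" by (auto simp: fraction_def)
qed (rule fraction_eqI[OF assms])

lemma (in domain) fraction_mult:
  assumes "a \<in> carrier R" "b \<in> carrier R - {\<zero>}" "c \<in> carrier R" "d \<in> carrier R - {\<zero>}"
  shows "fraction R a b \<otimes>\<^bsub>fraction_field R\<^esub> fraction R c d = fraction R (a \<otimes> c) (b \<otimes> d)"
proof -
  have "fraction R (a' \<otimes> c') (b' \<otimes> d') = fraction R (a \<otimes> c) (b \<otimes> d)"
    if "(a', b') \<in> fraction R a b" "(c', d') \<in> fraction R c d" for a' b' c' d'
  proof (rule fraction_eqI)
    have cl: "a' \<in> carrier R" "b' \<in> carrier R - {\<zero>}" "c' \<in> carrier R" "d' \<in> carrier R - {\<zero>}"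
      and eq: "a \<otimes> b' = a' \<otimes> b" "c \<otimes> d' = c' \<otimes> d" using that by (auto simp: fraction_def)
    show "a' \<otimes> c' \<in> carrier R" "b' \<otimes> d' \<in> carrier R - {\<zero>}" "a \<otimes> c \<in> carrier R" "b \<otimes> d \<in> carrier R - {\<zero>}"
      using cl assms by (auto simp: integral_iff)
    have "(a' \<otimes> c') \<otimes> (b \<otimes> d) = (a' \<otimes> b) \<otimes> (c' \<otimes> d)" using cl assms by (simp add: m_ac)
    also have "\<dots> = (a \<otimes> c) \<otimes> (b' \<otimes> d')" unfolding eq[symmetric] using cl assms by (simp add: m_ac)
    finally show "(a' \<otimes> c') \<otimes> (b \<otimes> d) = (a \<otimes> c) \<otimes> (b' \<otimes> d')" .
  qed
  moreover have "(a, b) \<in> fraction R a b" "(c, d) \<in> fraction R c d" using assms by (simp_all add: fraction_def)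
  ultimately show ?thesis
    unfolding fraction_field_def monoid.simps ring.simps by (intro UN_pairs_const)
qed

lemma (in domain) fraction_add:
  assumes "a \<in> carrier R" "b \<in> carrier R - {\<zero>}" "c \<in> carrier R" "d \<in> carrier R - {\<zero>}"
  shows "fraction R a b \<oplus>\<^bsub>fraction_field R\<^esub> fraction R c d = fraction R (a \<otimes> d \<oplus> c \<otimes> b) (b \<otimes> d)"
proof -
  have "fraction R (a' \<otimes> d' \<oplus> c' \<otimes> b') (b' \<otimes> d') = fraction R (a \<otimes> d \<oplus> c \<otimes> b) (b \<otimes> d)"
    if "(a', b') \<in> fraction R a b" "(c', d') \<in> fraction R c d" for a' b' c' d'
  proof (rule fraction_eqI)
    have cl: "a' \<in> carrier R" "b' \<in> carrier R - {\<zero>}" "c' \<in> carrier R" "d' \<in> carrier R - {\<zero>}"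
      and eq: "a \<otimes> b' = a' \<otimes> b" "c \<otimes> d' = c' \<otimes> d" using that by (auto simp: fraction_def)
    show "a' \<otimes> d' \<oplus> c' \<otimes> b' \<in> carrier R" "b' \<otimes> d' \<in> carrier R - {\<zero>}"
      "a \<otimes> d \<oplus> c \<otimes> b \<in> carrier R" "b \<otimes> d \<in> carrier R - {\<zero>}"
      using cl assms by (auto simp: integral_iff)
    have "(a' \<otimes> d' \<oplus> c' \<otimes> b') \<otimes> (b \<otimes> d) = (a' \<otimes> b) \<otimes> (d' \<otimes> d) \<oplus> (c' \<otimes> d) \<otimes> (b' \<otimes> b)"
      using cl assms by (simp add: m_ac l_distr r_distr)
    also have "\<dots> = (a \<otimes> d \<oplus> c \<otimes> b) \<otimes> (b' \<otimes> d')"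
      unfolding eq[symmetric] using cl assms by (simp add: m_ac l_distr r_distr)
    finally show "(a' \<otimes> d' \<oplus> c' \<otimes> b') \<otimes> (b \<otimes> d) = (a \<otimes> d \<oplus> c \<otimes> b) \<otimes> (b' \<otimes> d')" .
  qed
  moreover have "(a, b) \<in> fraction R a b" "(c, d) \<in> fraction R c d" using assms by (simp_all add: fraction_def)
  ultimately show ?thesis
    unfolding fraction_field_def monoid.simps ring.simps by (intro UN_pairs_const)
qed

lemma (in domain) fraction_closed:
  "\<lbrakk>a \<in> carrier R; b \<in> carrier R - {\<zero>}\<rbrakk> \<Longrightarrow> fraction R a b \<in> carrier (fraction_field R)"
  unfolding fraction_field_def by auto

lemma (in domain) fraction_cases:
  assumes "x \<in> carrier (fraction_field R)"
  obtains a b where "x = fraction R a b" "a \<in> carrier R" "b \<in> carrier R" "b \<noteq> \<zero>"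
  using assms unfolding fraction_field_def by auto

lemma (in domain) fraction_field_consts:
  "\<one>\<^bsub>fraction_field R\<^esub> = fraction R \<one> \<one>" "\<zero>\<^bsub>fraction_field R\<^esub> = fraction R \<zero> \<one>"
  by (simp_all add: fraction_field_def)

text \<open>Once all elements are written as fractions, \<open>fraction_eq_iff\<close> turns each
  equational axiom into a polynomial identity in the domain.\<close>

lemma (in domain) cring_fraction_field: "cring (fraction_field R)"
proof (rule cringI)
  note [simp] = fraction_add fraction_mult fraction_closed fraction_eq_iff fraction_field_consts integral_iff
  show "abelian_group (fraction_field R)"
  proof (rule abelian_groupI)
    fix x y z assume "x \<in> carrier (fraction_field R)" "y \<in> carrier (fraction_field R)" "z \<in> carrier (fraction_field R)"
    then show "x \<oplus>\<^bsub>fraction_field R\<^esub> y \<oplus>\<^bsub>fraction_field R\<^esub> z = x \<oplus>\<^bsub>fraction_field R\<^esub> (y \<oplus>\<^bsub>fraction_field R\<^esub> z)"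
      by (elim fraction_cases) (simp add: m_ac a_ac l_distr r_distr)
  next
    fix x y assume "x \<in> carrier (fraction_field R)" "y \<in> carrier (fraction_field R)"
    then show "x \<oplus>\<^bsub>fraction_field R\<^esub> y \<in> carrier (fraction_field R)"
      "x \<oplus>\<^bsub>fraction_field R\<^esub> y = y \<oplus>\<^bsub>fraction_field R\<^esub> x"
      by (elim fraction_cases; simp add: m_ac a_ac)+
  next
    fix x assume "x \<in> carrier (fraction_field R)"
    then show "\<zero>\<^bsub>fraction_field R\<^esub> \<oplus>\<^bsub>fraction_field R\<^esub> x = x"
      by (elim fraction_cases) (simp add: m_ac)
    show "\<exists>y\<in>carrier (fraction_field R). y \<oplus>\<^bsub>fraction_field R\<^esub> x = \<zero>\<^bsub>fraction_field R\<^esub>"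
      using \<open>x \<in> _\<close>
    proof (elim fraction_cases)
      fix a b assume "x = fraction R a b" "a \<in> carrier R" "b \<in> carrier R" "b \<noteq> \<zero>"
      then show ?thesis
        by (intro bexI[of _ "fraction R (\<ominus> a) b"]) (simp_all add: l_minus l_neg)
    qed
  qed simp
  show "comm_monoid (fraction_field R)"
  proof (rule comm_monoidI)
    fix x y z assume "x \<in> carrier (fraction_field R)" "y \<in> carrier (fraction_field R)" "z \<in> carrier (fraction_field R)"
    then show "x \<otimes>\<^bsub>fraction_field R\<^esub> y \<otimes>\<^bsub>fraction_field R\<^esub> z = x \<otimes>\<^bsub>fraction_field R\<^esub> (y \<otimes>\<^bsub>fraction_field R\<^esub> z)"
      by (elim fraction_cases) (simp add: m_ac)
  next
    fix x y assume "x \<in> carrier (fraction_field R)" "y \<in> carrier (fraction_field R)"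
    then show "x \<otimes>\<^bsub>fraction_field R\<^esub> y \<in> carrier (fraction_field R)"
      "x \<otimes>\<^bsub>fraction_field R\<^esub> y = y \<otimes>\<^bsub>fraction_field R\<^esub> x"
      by (elim fraction_cases; simp add: m_ac)+
  next
    fix x assume "x \<in> carrier (fraction_field R)"
    then show "\<one>\<^bsub>fraction_field R\<^esub> \<otimes>\<^bsub>fraction_field R\<^esub> x = x"
      by (elim fraction_cases) simp
  qed simp
  fix x y z assume "x \<in> carrier (fraction_field R)" "y \<in> carrier (fraction_field R)" "z \<in> carrier (fraction_field R)"
  then show "(x \<oplus>\<^bsub>fraction_field R\<^esub> y) \<otimes>\<^bsub>fraction_field R\<^esub> z =
      x \<otimes>\<^bsub>fraction_field R\<^esub> z \<oplus>\<^bsub>fraction_field R\<^esub> y \<otimes>\<^bsub>fraction_field R\<^esub> z"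
    by (elim fraction_cases) (simp add: m_ac l_distr r_distr)
qed

lemma (in domain) fraction_hom: "(\<lambda>a. fraction R a \<one>) \<in> ring_hom R (fraction_field R)"
  by (rule ring_hom_memI) (simp_all add: fraction_closed fraction_mult fraction_add fraction_field_consts)

text \<open>For c = x/y, bc = 0 means that the product of b + s and \<open>x\<close> vanishes in
  B/s. As \<open>s\<close> is prime, B/s is a domain, so b \<in> s or x = 0.\<close>

lemma residue_module_residue_field:
  assumes "cring B" "primeideal s B"
  shows "residue_module B s (residue_field B s)"
proof -
  interpret B: cring B by fact
  interpret s: primeideal s B by fact
  interpret Q: domain "B Quot s" by (rule s.quotient_is_domain)
  let ?F = "fraction_field (B Quot s)" and ?\<phi> = "\<lambda>b. fraction (B Quot s) (s +>\<^bsub>B\<^esub> b) \<one>\<^bsub>B Quot s\<^esub>"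
  interpret F: cring ?F by (rule Q.cring_fraction_field)
  have proj: "(\<lambda>b. s +>\<^bsub>B\<^esub> b) \<in> ring_hom B (B Quot s)" by (rule s.rcos_ring_hom)
  have hom: "?\<phi> \<in> ring_hom B ?F"
    using ring_hom_trans[OF proj Q.fraction_hom] by (simp add: comp_def)
  have mod: "module B (residue_field B s)"
    unfolding residue_field_def by (intro module_restrict_scalars[where R = ?F] hom F.module_regular assms(1))
  have carr: "carrier (residue_field B s) = carrier ?F" and zero: "\<zero>\<^bsub>residue_field B s\<^esub> = \<zero>\<^bsub>?F\<^esub>"
    and smult: "\<And>b c. b \<odot>\<^bsub>residue_field B s\<^esub> c = ?\<phi> b \<otimes>\<^bsub>?F\<^esub> c"
    by (simp_all add: residue_field_def)
  have zs: "\<zero>\<^bsub>B Quot s\<^esub> = s" by (simp add: FactRing_def)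
  have "b \<odot>\<^bsub>residue_field B s\<^esub> c = \<zero>\<^bsub>residue_field B s\<^esub> \<longleftrightarrow> b \<in> s \<or> c = \<zero>\<^bsub>residue_field B s\<^esub>"
    if b: "b \<in> carrier B" and c: "c \<in> carrier (residue_field B s)" for b c
  proof -
    obtain x y where xy: "c = fraction (B Quot s) x y" "x \<in> carrier (B Quot s)" "y \<in> carrier (B Quot s)"
      "y \<noteq> \<zero>\<^bsub>B Quot s\<^esub>" using c unfolding carr by (elim Q.fraction_cases)
    have sb: "s +>\<^bsub>B\<^esub> b \<in> carrier (B Quot s)" using ring_hom_closed[OF proj b] .
    have "s +>\<^bsub>B\<^esub> b = \<zero>\<^bsub>B Quot s\<^esub> \<longleftrightarrow> b \<in> s"
      using s.rcos_const_imp_mem[OF b] s.a_rcos_const[of b] unfolding zs by blast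
    then show ?thesis
      using xy sb by (simp add: smult zero Q.fraction_field_consts Q.fraction_mult Q.fraction_eq_iff Q.integral_iff)
  qed
  moreover have "\<one>\<^bsub>?F\<^esub> \<noteq> \<zero>\<^bsub>?F\<^esub>"
    by (simp add: Q.fraction_field_consts Q.fraction_eq_iff)
  ultimately show ?thesis
    using mod F.one_closed unfolding residue_module_def carr zero by blast
qed

section \<open>Countable bases\<close>

text \<open>Zorn's lemma is applied to the independent subsets of \<open>U\<close>, so that the
  basis obtained is countable if \<open>U\<close> is.\<close>

lemma (in vectorspace) basis_in_spanning_set:
  assumes U: "U \<subseteq> carrier V" and span: "span U = carrier V"
  obtains I where "I \<subseteq> U" "lin_indpt I" "span I = carrier V"
proof -
  let ?A = "{S. S \<subseteq> U \<and> lin_indpt S}"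
  have "\<exists>I\<in>?A. \<forall>S\<in>?A. I \<subseteq> S \<longrightarrow> S = I"
  proof (rule subset_Zorn_nonempty)
    have "{} \<in> ?A" by (auto simp: lin_dep_def)
    then show "?A \<noteq> {}" by blast
  next
    fix \<C> assume \<C>: "\<C> \<noteq> {}" "subset.chain ?A \<C>"
    then have sub: "\<C> \<subseteq> ?A" by (simp add: subset_chain_def)
    have "lin_indpt (\<Union>\<C>)"
    proof
      assume "lin_dep (\<Union>\<C>)"
      then obtain F a v where F: "finite F" "F \<subseteq> \<Union>\<C>" and av: "a \<in> F \<rightarrow> carrier K" "lincomb a F = \<zero>\<^bsub>V\<^esub>"
        "v \<in> F" "a v \<noteq> \<zero>\<^bsub>K\<^esub>" unfolding lin_dep_def by blast
      \<comment> \<open>A linear dependency involves finitely many vectors, which lie together in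
        one member of the chain.\<close>
      obtain S where "S \<in> \<C>" "F \<subseteq> S"
        using finite_subset_Union_chain[OF F \<C>] by blast
      moreover have "lin_dep S" by (rule lin_dep_crit[OF F(1) \<open>F \<subseteq> S\<close> av(1,3,4,2)])
      ultimately show False using sub by blast
    qed
    then show "\<Union>\<C> \<in> ?A" using sub by blast
  qed
  then obtain I where "I \<in> ?A" and max: "\<forall>S\<in>?A. I \<subseteq> S \<longrightarrow> S = I" by (rule bexE)
  then have I: "I \<subseteq> U" "lin_indpt I" by simp_all
  have IV: "I \<subseteq> carrier V" using I(1) U by blast
  have "U \<subseteq> span I"
  proof
    fix u assume u: "u \<in> U"
    show "u \<in> span I"
    proof (cases "u \<in> I")
      case True
      then show ?thesis using in_own_span[OF IV] by blast
    next
      case False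
      then have "I \<union> {u} \<noteq> I" by blast
      then have "lin_dep (I \<union> {u})" using bspec[OF max, of "I \<union> {u}"] I(1) u by auto
      then show ?thesis using lin_dep_iff_in_span[OF IV I(2)] False u U by blast
    qed
  qed
  then have "span U \<subseteq> span I" by (rule span_is_subset[OF _ span_is_submodule[OF IV]])
  then have "span I = carrier V" using span span_is_subset2[OF IV] by blast
  then show thesis using I that by blast
qed

text \<open>Coordinates are handled through the relation \<open>rep x a\<close>: the scalars
  \<open>a\<close> expand \<open>x\<close>. It is compatible with sums and scalar multiples, and
  independence makes \<open>a\<close> unique on \<open>I\<close>; linearity of the chosen
  coordinates \<open>co\<close> then follows from uniqueness.\<close>

lemma (in vectorspace) dual_basis_exists:
  assumes I: "I \<subseteq> carrier V" "lin_indpt I" "span I = carrier V"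
  shows "\<exists>\<phi>. dual_basis K V I (\<lambda>v. v) \<phi>"
proof -
  define rep where "rep x a \<longleftrightarrow> (\<forall>v\<in>I. a v \<in> carrier K) \<and>
    (\<exists>S. finite S \<and> S \<subseteq> I \<and> (\<forall>F. finite F \<and> S \<subseteq> F \<and> F \<subseteq> I \<longrightarrow> finsum V (\<lambda>v. a v \<odot>\<^bsub>V\<^esub> v) F = x))" for x a
  have repI: "rep x a" if "\<And>v. v \<in> I \<Longrightarrow> a v \<in> carrier K" "finite S" "S \<subseteq> I"
    "\<And>F. \<lbrakk>finite F; S \<subseteq> F; F \<subseteq> I\<rbrakk> \<Longrightarrow> finsum V (\<lambda>v. a v \<odot>\<^bsub>V\<^esub> v) F = x" for x a S
    unfolding rep_def using that by (intro conjI ballI exI[of _ S] allI impI) auto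
  have repE: "\<exists>S. finite S \<and> S \<subseteq> I \<and> (\<forall>F. finite F \<and> S \<subseteq> F \<and> F \<subseteq> I \<longrightarrow> finsum V (\<lambda>v. a v \<odot>\<^bsub>V\<^esub> v) F = x)"
    and rep_closed: "\<And>v. v \<in> I \<Longrightarrow> a v \<in> carrier K" if "rep x a" for x a
    using that by (auto simp: rep_def)
  have cl: "(\<lambda>v. a v \<odot>\<^bsub>V\<^esub> v) \<in> F \<rightarrow> carrier V" if "rep x a" "F \<subseteq> I" for x a F
    using rep_closed[OF that(1)] that(2) I(1) by (auto simp: subset_iff)
  have rep_ex: "\<exists>a. rep x a" if "x \<in> carrier V" for x
  proof -
    from that I(3) have "x \<in> span I" by simp
    then obtain a S where S: "finite S" "S \<subseteq> I" "a \<in> S \<rightarrow> carrier K" "lincomb a S = x"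
      unfolding span_def by blast
    \<comment> \<open>Extended by zero, the coefficients on \<open>S\<close> also give
      \<open>x\<close> over every larger finite set.\<close>
    let ?b = "\<lambda>v. if v \<in> S then a v else \<zero>\<^bsub>K\<^esub>"
    have "finsum V (\<lambda>v. ?b v \<odot>\<^bsub>V\<^esub> v) F = x" if "finite F" "S \<subseteq> F" "F \<subseteq> I" for F
    proof -
      have "finsum V (\<lambda>v. a v \<odot>\<^bsub>V\<^esub> v) S = finsum V (\<lambda>v. ?b v \<odot>\<^bsub>V\<^esub> v) F"
        by (rule M.add.finprod_mono_neutral_cong_left)
          (use that S I(1) in \<open>auto simp: subset_iff Pi_iff\<close>)
      then show ?thesis using S(4) by (simp add: lincomb_def)
    qed
    then have "rep x ?b" using S by (intro repI[of ?b S]) auto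
    then show ?thesis by blast
  qed
  have rep_add: "rep (x \<oplus>\<^bsub>V\<^esub> y) (\<lambda>v. a v \<oplus>\<^bsub>K\<^esub> b v)" if a: "rep x a" and b: "rep y b" for x y a b
  proof -
    from repE[OF a] obtain S where S: "finite S" "S \<subseteq> I"
      "\<And>F. finite F \<and> S \<subseteq> F \<and> F \<subseteq> I \<Longrightarrow> finsum V (\<lambda>v. a v \<odot>\<^bsub>V\<^esub> v) F = x" by blast
    from repE[OF b] obtain S' where S': "finite S'" "S' \<subseteq> I"
      "\<And>F. finite F \<and> S' \<subseteq> F \<and> F \<subseteq> I \<Longrightarrow> finsum V (\<lambda>v. b v \<odot>\<^bsub>V\<^esub> v) F = y" by blast
    show ?thesis
    proof (rule repI[of _ "S \<union> S'"])
      fix F assume F: "finite F" "S \<union> S' \<subseteq> F" "F \<subseteq> I"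
      have "finsum V (\<lambda>v. (a v \<oplus>\<^bsub>K\<^esub> b v) \<odot>\<^bsub>V\<^esub> v) F = finsum V (\<lambda>v. a v \<odot>\<^bsub>V\<^esub> v \<oplus>\<^bsub>V\<^esub> b v \<odot>\<^bsub>V\<^esub> v) F"
        by (rule M.finsum_cong')
          (use F I(1) rep_closed[OF a] rep_closed[OF b] in \<open>auto simp: subset_iff smult_l_distr\<close>)
      also have "\<dots> = finsum V (\<lambda>v. a v \<odot>\<^bsub>V\<^esub> v) F \<oplus>\<^bsub>V\<^esub> finsum V (\<lambda>v. b v \<odot>\<^bsub>V\<^esub> v) F"
        by (rule M.finsum_addf[OF cl[OF a F(3)] cl[OF b F(3)]])
      also have "\<dots> = x \<oplus>\<^bsub>V\<^esub> y" using F by (simp add: S(3) S'(3))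
      finally show "finsum V (\<lambda>v. (a v \<oplus>\<^bsub>K\<^esub> b v) \<odot>\<^bsub>V\<^esub> v) F = x \<oplus>\<^bsub>V\<^esub> y" .
    qed (use S(1,2) S'(1,2) rep_closed[OF a] rep_closed[OF b] in auto)
  qed
  have rep_smult: "rep (c \<odot>\<^bsub>V\<^esub> x) (\<lambda>v. c \<otimes>\<^bsub>K\<^esub> a v)" if c: "c \<in> carrier K" and a: "rep x a" for c x a
  proof -
    from repE[OF a] obtain S where S: "finite S" "S \<subseteq> I"
      "\<And>F. finite F \<and> S \<subseteq> F \<and> F \<subseteq> I \<Longrightarrow> finsum V (\<lambda>v. a v \<odot>\<^bsub>V\<^esub> v) F = x" by blast
    show ?thesis
    proof (rule repI[of _ S])
      fix F assume F: "finite F" "S \<subseteq> F" "F \<subseteq> I"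
      have "finsum V (\<lambda>v. (c \<otimes>\<^bsub>K\<^esub> a v) \<odot>\<^bsub>V\<^esub> v) F = finsum V (\<lambda>v. c \<odot>\<^bsub>V\<^esub> (a v \<odot>\<^bsub>V\<^esub> v)) F"
        by (rule M.finsum_cong')
          (use F I(1) c rep_closed[OF a] in \<open>auto simp: subset_iff smult_assoc1\<close>)
      also have "\<dots> = c \<odot>\<^bsub>V\<^esub> finsum V (\<lambda>v. a v \<odot>\<^bsub>V\<^esub> v) F"
        by (rule finsum_smult_ldistr[OF F(1) c cl[OF a F(3)], symmetric])
      also have "\<dots> = c \<odot>\<^bsub>V\<^esub> x" using F by (simp add: S(3))
      finally show "finsum V (\<lambda>v. (c \<otimes>\<^bsub>K\<^esub> a v) \<odot>\<^bsub>V\<^esub> v) F = c \<odot>\<^bsub>V\<^esub> x" .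
    qed (use S(1,2) c rep_closed[OF a] in auto)
  qed
  have rep_zero: "a v = \<zero>\<^bsub>K\<^esub>" if a: "rep \<zero>\<^bsub>V\<^esub> a" and v: "v \<in> I" for a v
  proof (rule ccontr)
    assume nz: "a v \<noteq> \<zero>\<^bsub>K\<^esub>"
    from repE[OF a] obtain S where S: "finite S" "S \<subseteq> I"
      "\<And>F. finite F \<and> S \<subseteq> F \<and> F \<subseteq> I \<Longrightarrow> finsum V (\<lambda>v. a v \<odot>\<^bsub>V\<^esub> v) F = \<zero>\<^bsub>V\<^esub>" by blast
    \<comment> \<open>Inserting \<open>v\<close> brings the non-zero coefficient into the
      combination; the sum stays zero because the index set only grows.\<close>
    have "lincomb a (insert v S) = \<zero>\<^bsub>V\<^esub>"
      unfolding lincomb_def using S v by (intro S(3)) auto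
    then have "lin_dep I"
      using S(1,2) v nz rep_closed[OF a] by (intro lin_dep_crit[of "insert v S" I a v]) auto
    then show False using I(2) by blast
  qed
  have rep_unique: "a v = b v" if a: "rep x a" and b: "rep x b" and v: "v \<in> I" and x: "x \<in> carrier V" for x a b v
  proof -
    \<comment> \<open>The difference of the two expansions, formed with the scalar -1, is an
      expansion of zero.\<close>
    have "rep (x \<oplus>\<^bsub>V\<^esub> (\<ominus>\<^bsub>K\<^esub> \<one>\<^bsub>K\<^esub>) \<odot>\<^bsub>V\<^esub> x) (\<lambda>v. a v \<oplus>\<^bsub>K\<^esub> (\<ominus>\<^bsub>K\<^esub> \<one>\<^bsub>K\<^esub>) \<otimes>\<^bsub>K\<^esub> b v)"
      by (intro rep_add rep_smult a b) simp
    moreover have "x \<oplus>\<^bsub>V\<^esub> (\<ominus>\<^bsub>K\<^esub> \<one>\<^bsub>K\<^esub>) \<odot>\<^bsub>V\<^esub> x = \<zero>\<^bsub>V\<^esub>"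
      using x by (simp add: smult_l_minus M.r_neg)
    ultimately have "a v \<oplus>\<^bsub>K\<^esub> (\<ominus>\<^bsub>K\<^esub> \<one>\<^bsub>K\<^esub>) \<otimes>\<^bsub>K\<^esub> b v = \<zero>\<^bsub>K\<^esub>"
      using rep_zero v by simp
    then have "a v \<ominus>\<^bsub>K\<^esub> b v = \<zero>\<^bsub>K\<^esub>"
      using rep_closed[OF a v] rep_closed[OF b v] by (simp add: R.minus_eq R.l_minus)
    then show ?thesis using rep_closed[OF a v] rep_closed[OF b v] by simp
  qed
  define co where "co x = (SOME a. rep x a)" for x
  have co: "rep x (co x)" if "x \<in> carrier V" for x
    unfolding co_def using rep_ex[OF that] by (rule someI_ex)
  have co_eq: "co x v = a v" if "rep x a" "x \<in> carrier V" "v \<in> I" for x a v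
    using rep_unique[OF co[OF that(2)] that(1,3,2)] .
  have "rep w (\<lambda>v. if v = w then \<one>\<^bsub>K\<^esub> else \<zero>\<^bsub>K\<^esub>)" if w: "w \<in> I" for w
  proof (rule repI[of _ "{w}"])
    fix F assume F: "finite F" "{w} \<subseteq> F" "F \<subseteq> I"
    have "finsum V (\<lambda>v. (if v = w then \<one>\<^bsub>K\<^esub> else \<zero>\<^bsub>K\<^esub>) \<odot>\<^bsub>V\<^esub> v) F = finsum V (\<lambda>v. if w = v then v else \<zero>\<^bsub>V\<^esub>) F"
      by (rule M.finsum_cong') (use F I(1) in \<open>auto simp: subset_iff\<close>)
    also have "\<dots> = w"
      by (rule M.finsum_singleton) (use F I(1) in \<open>auto simp: subset_iff\<close>)
    finally show "finsum V (\<lambda>v. (if v = w then \<one>\<^bsub>K\<^esub> else \<zero>\<^bsub>K\<^esub>) \<odot>\<^bsub>V\<^esub> v) F = w" .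
  qed (use w in auto)
  then have co_basis: "co w v = (if v = w then \<one>\<^bsub>K\<^esub> else \<zero>\<^bsub>K\<^esub>)" if "w \<in> I" "v \<in> I" for v w
    using co_eq[of w _ v] that I(1) by blast
  have co_hom: "(\<lambda>x. co x v) \<in> module_hom K V (regular_module K)" if "v \<in> I" for v
    unfolding module_hom_def
    using rep_closed[OF co that] co_eq[OF rep_add[OF co co] _ that] co_eq[OF rep_smult[OF _ co] _ that]
    by simp
  have "dual_basis K V I (\<lambda>v. v) (\<lambda>v x. co x v)"
    unfolding dual_basis_def
  proof (intro conjI ballI)
    fix x assume "x \<in> carrier V"
    then show "\<exists>F\<^sub>0. finite F\<^sub>0 \<and> F\<^sub>0 \<subseteq> I \<and> (\<forall>F. finite F \<and> F\<^sub>0 \<subseteq> F \<and> F \<subseteq> I \<longrightarrow>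
      finsum V (\<lambda>v. co x v \<odot>\<^bsub>V\<^esub> v) F = x)" by (rule repE[OF co])
  qed (use I(1) co_hom co_basis in auto)
  then show ?thesis by blast
qed

text \<open>Words in the algebra generators applied to the module generators span \<open>M\<close>
  over \<open>K\<close>: their span \<open>W\<close> is stable under each algebra generator, hence
  under all of \<open>A\<close>, and contains the module generators.\<close>

lemma countable_spanning_set:
  assumes A: "finite_type_algebra K A" and M: "module A M" "finitely_generated A M"
  shows "\<exists>U. countable U \<and> U \<subseteq> carrier M \<and>
    LinearCombinations.module.span K (restrict_scalars (structure_map A) M) U = carrier M"
proof -
  let ?V = "restrict_scalars (structure_map A) M"
  interpret A: algebra K A using A by (simp add: finite_type_algebra_def)
  interpret M: module A M by fact
  interpret V: module K ?V by (intro module_restrict_structure_map A.algebra_axioms M)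
  obtain S where S: "finite S" "S \<subseteq> carrier A" "generate_ring A (structure_map A ` carrier K \<union> S) = carrier A"
    using A by (auto simp: finite_type_algebra_def)
  obtain G where G: "finite G" "G \<subseteq> carrier M" "M.span G = carrier M"
    using M(2) by (auto simp: finitely_generated_def)
  let ?act = "\<lambda>l g. foldr (\<lambda>a m. a \<odot>\<^bsub>M\<^esub> m) l g"
  \<comment> \<open>Monomials are encoded as lists; lists over a finite set form a countable
    set.\<close>
  define U where "U = (\<lambda>(l, g). ?act l g) ` (lists S \<times> G)"
  define W where "W = V.span U"
  have U_countable: "countable U"
    unfolding U_def using S(1) G(1) by (intro countable_image countable_SIGMA countable_lists countable_finite)
  have act_closed: "?act l g \<in> carrier M" if "l \<in> lists S" "g \<in> G" for l g
    using that S(2) G(2) by (induction l) auto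
  then have U: "U \<subseteq> carrier M" by (auto simp: U_def)
  have W: "submodule K W ?V" unfolding W_def by (rule V.span_is_submodule) (use U in simp)
  have WM: "W \<subseteq> carrier M" using submodule.subset[OF W] by simp
  have UW: "U \<subseteq> W" unfolding W_def by (rule V.in_own_span) (use U in simp)
  have SU: "h \<odot>\<^bsub>M\<^esub> u \<in> U" if "h \<in> S" "u \<in> U" for h u
  proof -
    from that(2) obtain l g where "u = ?act l g" "l \<in> lists S" "g \<in> G" by (auto simp: U_def)
    then have "h \<odot>\<^bsub>M\<^esub> u = (\<lambda>(l, g). ?act l g) (h # l, g)" "(h # l, g) \<in> lists S \<times> G" using that(1) by auto
    then show ?thesis unfolding U_def by (rule image_eqI)
  qed
  have W_smult: "structure_map A c \<odot>\<^bsub>M\<^esub> x \<in> W" if "c \<in> carrier K" "x \<in> W" for c x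
    using submodule.smult_closed[OF W that] by simp
  have sm: "structure_map A c \<in> carrier A" if "c \<in> carrier K" for c
    using ring_hom_closed[OF A.structure_map_hom that] .
  have SW: "h \<odot>\<^bsub>M\<^esub> x \<in> W" if h: "h \<in> S" and x: "x \<in> W" for h x
  proof -
    have hA: "h \<in> carrier A" using h S(2) by blast
    \<comment> \<open>Stability under \<open>h\<close> is reduced to \<open>U\<close>: the elements
      of \<open>W\<close> that \<open>h\<close> maps back into \<open>W\<close> form a
      \<open>K\<close>-submodule.\<close>
    let ?N = "{x \<in> W. h \<odot>\<^bsub>M\<^esub> x \<in> W}"
    have "submodule K ?N ?V"
    proof (rule submodule.intro)
      show "Module.module K ?V" by (rule V.module_axioms)
      show "?N \<subseteq> carrier ?V" using WM by auto
      show "\<zero>\<^bsub>?V\<^esub> \<in> ?N" using submodule.zero_closed[OF W] hA by simp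
      show "v \<oplus>\<^bsub>?V\<^esub> w \<in> ?N" if "v \<in> ?N" "w \<in> ?N" for v w
      proof -
        have "v \<in> carrier M" "w \<in> carrier M" using that WM by auto
        then have "h \<odot>\<^bsub>M\<^esub> (v \<oplus>\<^bsub>M\<^esub> w) = h \<odot>\<^bsub>M\<^esub> v \<oplus>\<^bsub>M\<^esub> h \<odot>\<^bsub>M\<^esub> w" using hA by (simp add: M.smult_r_distr)
        then show ?thesis using that submodule.m_closed[OF W] by simp
      qed
      show "c \<odot>\<^bsub>?V\<^esub> v \<in> ?N" if c: "c \<in> carrier K" and v: "v \<in> ?N" for c v
      proof -
        have "v \<in> carrier M" using v WM by auto
        then have "h \<odot>\<^bsub>M\<^esub> (structure_map A c \<odot>\<^bsub>M\<^esub> v) = structure_map A c \<odot>\<^bsub>M\<^esub> (h \<odot>\<^bsub>M\<^esub> v)"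
          using hA sm[OF c] A.m_comm[of h "structure_map A c"] by (simp flip: M.smult_assoc1)
        then show ?thesis using v c W_smult by simp
      qed
    qed
    moreover have "U \<subseteq> ?N" using UW SU[OF h] by blast
    ultimately have "W \<subseteq> ?N" unfolding W_def by (intro V.span_is_subset)
    then show ?thesis using x by blast
  qed
  have "a \<in> carrier A \<and> (\<forall>x\<in>W. a \<odot>\<^bsub>M\<^esub> x \<in> W)"
    if "a \<in> generate_ring A (structure_map A ` carrier K \<union> S)" for a
    using that
  proof (induction rule: generate_ring.induct)
    case one
    then show ?case using WM by (auto simp: subset_iff)
  next
    case (incl h)
    then show ?case using W_smult SW sm S(2) by blast
  next
    case (a_inv h)
    have "(\<ominus>\<^bsub>A\<^esub> h) \<odot>\<^bsub>M\<^esub> x \<in> W" if x: "x \<in> W" for x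
    proof -
      have hx: "h \<odot>\<^bsub>M\<^esub> x \<in> W" "h \<odot>\<^bsub>M\<^esub> x \<in> carrier M" using a_inv x WM by auto
      have "(\<ominus>\<^bsub>A\<^esub> h) \<odot>\<^bsub>M\<^esub> x = \<ominus>\<^bsub>M\<^esub> (h \<odot>\<^bsub>M\<^esub> x)"
        by (rule M.smult_l_minus) (use a_inv x WM in auto)
      \<comment> \<open>Negation is rewritten as the scalar -1 of \<open>K\<close>, under which a
        \<open>K\<close>-submodule is closed; \<open>M\<close> and \<open>?V\<close> share their
        additive structure.\<close>
      also have "\<dots> = \<ominus>\<^bsub>?V\<^esub> (h \<odot>\<^bsub>M\<^esub> x)" by (simp add: a_inv_def m_inv_def)
      also have "\<dots> = (\<ominus>\<^bsub>K\<^esub> \<one>\<^bsub>K\<^esub>) \<odot>\<^bsub>?V\<^esub> (h \<odot>\<^bsub>M\<^esub> x)"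
        using V.smult_l_minus[of "\<one>\<^bsub>K\<^esub>" "h \<odot>\<^bsub>M\<^esub> x"] V.smult_one[of "h \<odot>\<^bsub>M\<^esub> x"] hx
        by (simp del: restrict_scalars_simps(6) V.smult_one)
      also have "\<dots> \<in> W" by (rule submodule.smult_closed[OF W _ hx(1)]) simp
      finally show ?thesis .
    qed
    then show ?case using a_inv by simp
  next
    case (eng_add a b)
    have "(a \<oplus>\<^bsub>A\<^esub> b) \<odot>\<^bsub>M\<^esub> x \<in> W" if "x \<in> W" for x
    proof -
      have "(a \<oplus>\<^bsub>A\<^esub> b) \<odot>\<^bsub>M\<^esub> x = a \<odot>\<^bsub>M\<^esub> x \<oplus>\<^bsub>M\<^esub> b \<odot>\<^bsub>M\<^esub> x"
        by (rule M.smult_l_distr) (use eng_add that WM in auto)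
      then show ?thesis using eng_add that submodule.m_closed[OF W] by simp
    qed
    then show ?case using eng_add by simp
  next
    case (eng_mult a b)
    have "(a \<otimes>\<^bsub>A\<^esub> b) \<odot>\<^bsub>M\<^esub> x \<in> W" if "x \<in> W" for x
    proof -
      have "(a \<otimes>\<^bsub>A\<^esub> b) \<odot>\<^bsub>M\<^esub> x = a \<odot>\<^bsub>M\<^esub> (b \<odot>\<^bsub>M\<^esub> x)"
        by (rule M.smult_assoc1) (use eng_mult that WM in auto)
      then show ?thesis using eng_mult that by simp
    qed
    then show ?case using eng_mult A.m_closed by blast
  qed
  then have AW: "a \<odot>\<^bsub>M\<^esub> x \<in> W" if "a \<in> carrier A" "x \<in> W" for a x
    using that S(3) by blast
  have "submodule A W M"
    by (rule submodule.intro)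
      (use M.module_axioms WM submodule.zero_closed[OF W] submodule.m_closed[OF W] AW in auto)
  moreover have "G \<subseteq> W"
  proof
    fix g assume "g \<in> G"
    \<comment> \<open>Module generators arise from the empty word.\<close>
    then have "(\<lambda>(l, g). ?act l g) ([], g) \<in> U" unfolding U_def by (intro imageI) auto
    then show "g \<in> W" using UW by auto
  qed
  ultimately have "M.span G \<subseteq> W" by (intro M.span_is_subset)
  then have "W = carrier M" using G(3) WM by blast
  then show ?thesis using U_countable U unfolding W_def by blast
qed

section \<open>Very general points\<close>

lemma countable_dual_basis:
  assumes "field K" "finite_type_algebra K A" "module A M" "finitely_generated A M"
  shows "\<exists>I \<phi>. countable I \<and> dual_basis K (restrict_scalars (structure_map A) M) I (\<lambda>v. v) \<phi>"
proof -
  interpret V: vectorspace K "restrict_scalars (structure_map A) M"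
    using assms(2) by (intro vectorspace.intro module_restrict_structure_map assms(1,3))
      (simp add: finite_type_algebra_def)
  obtain U where U: "countable U" "U \<subseteq> carrier M" "V.span U = carrier M"
    using countable_spanning_set[OF assms(2-4)] by blast
  obtain I where I: "I \<subseteq> U" "V.lin_indpt I" "V.span I = carrier M"
    using V.basis_in_spanning_set[of U] U(2,3) by auto
  then obtain \<phi> where "dual_basis K (restrict_scalars (structure_map A) M) I (\<lambda>v. v) \<phi>"
    using V.dual_basis_exists[of I] U(2) by auto
  moreover have "countable I" using I(1) U(1) by (rule countable_subset)
  ultimately show ?thesis by blast
qed

lemma (in based_family) entry_closed:
  assumes "D \<in> module_hom B PB PB" "i \<in> I" "j \<in> I"
  shows "entry D j i \<in> carrier B"
proof -
  have "MB.pt (e j) \<one>\<^bsub>B\<^esub> \<in> carrier PB" using MBI.e_closed[OF assms(3)] by simp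
  then have "D (MB.pt (e j) \<one>\<^bsub>B\<^esub>) \<in> carrier PB" using assms(1) by (auto simp: module_hom_def)
  then show ?thesis using MBI.coord_closed[OF assms(2)] by (simp add: entry_def)
qed

text \<open>The fibre construction is the case C = kappa(s) of the base change above, with literally
  the same expressions, so the matrix criterion applies.\<close>

lemma (in based_family) zero_kernel_at_iff:
  assumes D: "D \<in> module_hom B PB PB" and s: "residue_module B s (residue_field B s)"
  shows "zero_kernel_at K A B M D s \<longleftrightarrow>
    (\<forall>F. finite F \<and> F \<subseteq> I \<longrightarrow> independent_columns (residue_field B s) I (entry D) F)"
proof -
  interpret s: module B "residue_field B s" using s by (simp add: residue_module_def)
  interpret s: based_family_fibre K A B M "residue_field B s" I e \<phi> ..
  have "fibre_iso K A B M s = s.to_fibre"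
    unfolding fibre_iso_def s.to_fibre_def s.act_def fibre_def ..
  then have "operator_at K A B M D s = s.op_at D"
    unfolding operator_at_def s.op_at_def s.base_change_def family_base_change_def by simp
  then show ?thesis
    unfolding zero_kernel_at_def fibre_def by (simp only: s.kernel_zero_iff[OF D])
qed

text \<open>Reduces the first alternative at \<open>s\<^sub>0\<close> to the second. Zero has to be
  shown to lie in the carrier, as the kernel must be exactly its singleton.\<close>

lemma zero_kernel_at_identity:
  assumes "algebra K A" "algebra K B" "module A M" "residue_module B s (residue_field B s)"
    and id: "\<forall>x\<in>carrier (fibre K A B M s). operator_at K A B M D s x = x"
  shows "zero_kernel_at K A B M D s"
proof -
  interpret s: module_pair K "restrict_scalars (structure_map A) M" "restrict_scalars (structure_map B) (residue_field B s)"
    using assms(1-4) by (intro module_pair.intro module_restrict_structure_map) (simp_all add: residue_module_def)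
  have "\<zero>\<^bsub>fibre K A B M s\<^esub> \<in> carrier (fibre K A B M s)"
    unfolding fibre_def by (rule s.T.zero_closed)
  then show ?thesis
    using id by (auto simp: zero_kernel_at_def a_kernel_def')
qed

theorem theorem4p16:
  fixes K :: "('k, 'y) ring_scheme"
    and A :: "('k, 'a, 'v) module_scheme"
    and B :: "('k, 'b, 'w) module_scheme"
    and M :: "('a, 'm, 'x) module_scheme"
    and D :: "('m \<times> 'b \<Rightarrow>\<^sub>0 int) set \<Rightarrow> ('m \<times> 'b \<Rightarrow>\<^sub>0 int) set"
    and r N :: nat
  assumes "field K" and "uncountable (carrier K)"
    and "finite_type_algebra K A" and "domain A"
    and "module A M" and "finitely_generated A M" and "torsion_free A M" and "module_rank A M = r"
    and "finite_type_algebra K B" and "domain B"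
    and "D \<in> diff_operator_families K A B M N"
    and "\<exists>s\<^sub>0 \<in> Spec B.
      (\<forall>x \<in> carrier (fibre K A B M s\<^sub>0). operator_at K A B M D s\<^sub>0 x = x) \<or>
      zero_kernel_at K A B M D s\<^sub>0"
  shows "very_general B (zero_kernel_at K A B M D)"
proof -
  have A: "algebra K A" and B: "algebra K B"
    using assms(3,9) by (simp_all add: finite_type_algebra_def)
  interpret family K A B M
    by (intro family.intro algebra_pair.intro A B assms(5))
  have D: "D \<in> module_hom B PB PB"
    using assms(11) by (simp add: diff_operator_families_def diff_operators_def)
  have res: "residue_module B s (residue_field B s)" if "s \<in> Spec B" for s
    using that by (intro residue_module_residue_field algebra.M_cring[OF B]) (simp add: Spec_def)
  obtain I \<phi> where I: "countable I" and \<phi>: "dual_basis K Mk I (\<lambda>v. v) \<phi>"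
    using countable_dual_basis[OF assms(1,3,5,6)] by blast
  interpret based_family K A B M I "\<lambda>v. v" \<phi>
    by (intro based_family.intro family_axioms based_family_axioms.intro \<phi>)
  obtain s\<^sub>0 where s\<^sub>0: "s\<^sub>0 \<in> Spec B" "zero_kernel_at K A B M D s\<^sub>0"
    using assms(12) zero_kernel_at_identity[OF A B assms(5) res] by blast
  have "\<exists>f\<in>carrier B - s\<^sub>0. \<forall>s\<in>Spec B. f \<notin> s \<longrightarrow> independent_columns (residue_field B s) I (entry D) F"
    if F: "finite F" "F \<subseteq> I" for F
  proof -
    have "independent_columns (residue_field B s\<^sub>0) I (entry D) F"
      using zero_kernel_at_iff[OF D res[OF s\<^sub>0(1)]] s\<^sub>0(2) F by blast
    moreover have "\<And>j i. \<lbrakk>j \<in> F; i \<in> I\<rbrakk> \<Longrightarrow> entry D j i \<in> carrier B"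
      using entry_closed[OF D] F by blast
    ultimately show ?thesis
      using independent_columns_open[OF F(1) _ res[OF s\<^sub>0(1)], of I "entry D"] res by blast
  qed
  \<comment> \<open>One witness is chosen for each finite set of columns, so that the exceptional
    sets are indexed by finite subsets of a countable set.\<close>
  then obtain f where f: "\<And>F. \<lbrakk>finite F; F \<subseteq> I\<rbrakk> \<Longrightarrow> f F \<in> carrier B - s\<^sub>0"
    and ind: "\<And>F s. \<lbrakk>finite F; F \<subseteq> I; s \<in> Spec B; f F \<notin> s\<rbrakk> \<Longrightarrow>
      independent_columns (residue_field B s) I (entry D) F"
    by metis
  \<comment> \<open>The closed set V(f F). It misses \<open>s\<^sub>0\<close> and is therefore
    proper; at a point outside all of them every finite set of columns is independent.\<close>
  let ?Z = "\<lambda>F. {p \<in> Spec B. {f F} \<subseteq> p}"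
  show ?thesis
    unfolding very_general_def
  proof (intro exI[of _ "?Z ` {F. finite F \<and> F \<subseteq> I}"] conjI ballI)
    show "countable (?Z ` {F. finite F \<and> F \<subseteq> I})"
      using countable_Collect_finite_subset[OF I] by (intro countable_image) (simp add: conj_commute)
  next
    fix Z assume "Z \<in> ?Z ` {F. finite F \<and> F \<subseteq> I}"
    then obtain F where F: "finite F" "F \<subseteq> I" "Z = ?Z F" by blast
    show "zariski_closed B Z"
      unfolding zariski_closed_def using F(3) f[OF F(1,2)] by (intro exI[of _ "{f F}"]) auto
    show "Z \<noteq> Spec B" using F(3) f[OF F(1,2)] s\<^sub>0(1) by auto
  next
    fix s assume s: "s \<in> Spec B - \<Union>(?Z ` {F. finite F \<and> F \<subseteq> I})"
    then show "zero_kernel_at K A B M D s"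
      using zero_kernel_at_iff[OF D res] ind by auto
  qed
qed

end
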